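(* Suppose $\beta_1\in X$ is convex and Lipschitz, and lies in a finite dimensional $\mathbb Q$-subspace of $X$ that is stable under $T_0$ and $T_1$. Set $E_1=\beta_1\,\#\,\phi_0$, where $\phi_0$ is the first member of the family $(\phi_m)_{m\ge0}$ defined recursively in the context, and let $t+E_1\in X$ denote the function $s\mapsto s+E_1(s)$. Then the power series $$\mathcal S_{t+E_1}(w)=\sum_{n\ge0}\bigl(2^{-n}+E_1(2^{-n})\bigr)(2w)^n\in\mathbb Q[[w]]$$ is algebraic over $\mathbb Q(w)$, and $\mu(t+E_1)=\lim_{n\to\infty}2^n\bigl(2^{-n}+E_1(2^{-n})\bigr)$ is algebraic over $\mathbb Q$.
   Context: Let $I=[0,1]\cap\mathbb Z[\tfrac12]$ and let $X$ be the $\mathbb Q$-vector space of all functions $I\to\mathbb Q$. The linear maps $T_0,T_1:X\to X$ are $T_0(\alpha)(t)=\alpha(\tfrac t2)$ and $T_1(\alpha)(t)=\alpha(\tfrac{1+t}2)$. An element $\alpha\in X$ is called convex if $2\alpha(\frac iq)\ge\alpha(\frac{i-1}q)+\alpha(\frac{i+1}q)$ for every power $q$ of $2$ and every integer $i$ with $0<i<q$ (note the direction of the inequality). For $\alpha\in X$ convex and Lipschitz with $\alpha(0)=0$, $\alpha(1)=1$ one puts $\mu(\alpha)=\lim_{n\to\infty}2^n\alpha(2^{-n})$ (the limit exists) and $\mathcal S_\alpha=\sum_{n\ge0}\alpha(2^{-n})(2w)^n\in\mathbb Q[[w]]$. The function $t+E_1$ is of this kind. Product $\#$. For $\alpha\in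 X$ put $\alpha_0=T_0(\alpha)$, $\alpha_1=T_1(\alpha)$. The bilinear product $\#:X\times X\to X$ is defined by induction on the denominator of $t\in I$: (1) $(\alpha\#\beta)(0)=0$ and $(\alpha\#\beta)(1)=(\alpha(1)-\alpha(0))(\beta(1)-\beta(0))$; (2) if $0\le t\le\frac12$, $(\alpha\#\beta)(t)=(\alpha_0\#\beta_0)(2t)+(\alpha_1\#\beta_1)(2t)$; (3) if $\frac12\le t\le1$, $(\alpha\#\beta)(t)=(\alpha_0\#\beta_0)(1)+(\alpha_1\#\beta_1)(1)+(\alpha_0\#\beta_1)(2t-1)+(\alpha_1\#\beta_0)(2t-1)$. (In this recursion $\beta_0=T_0(\beta)$ and $\beta_1=T_1(\beta)$; this is unrelated to the name $\beta_1$ in the claim.) The functions $\phi_m$. Let $\epsilon\in X$ be $\epsilon(t)=t-t^2$. For $m=0,1,2,\dots$, $\phi_m\in X$ is defined by induction on the denominator of $t$: (1) $\phi_m(0)=\phi_m(1)=0$; (2) if $0\le t\le\frac12$: $8\phi_m(t)=\phi_{m+1}(2t)+(8m+6)t$ for $m$ even, and $8\phi_m(t)=\phi_{m-1}(2t)+\epsilon(2t)+(8m+6)t$ for $m$ odd; (3) if $\frac12\le t\le1$: $8\phi_0(t)=\phi_0(2t-1)+6(1-t)$; (4) if $\frac12\le t\le1$: $8\phi_m(t)=\phi_{m-1}(2t-1)+\epsilon(2t-1)+(8m+6)(1-t)$ for $m\neq0$ even, and $8\phi_m(t)=\phi_{m+1}(2t-1)+(8m+6)(1-t)$ for $m$ odd.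 *)

theory Defs
  imports
    Complex_Main
    "HOL-Library.Function_Algebras"
    "HOL-Computational_Algebra.Computational_Algebra"
begin

section \<open>Functions on the dyadic rationals of the unit interval\<close>

definition dyadic_unit :: "rat set" where
  "dyadic_unit = {t. 0 \<le> t \<and> t \<le> 1 \<and> (\<exists>k::nat. t * 2 ^ k \<in> \<int>)}"

text \<open>
  A function from \<^term>\<open>dyadic_unit\<close> to the rationals is represented by its extension by zero to
  all rationals. This makes \<open>X\<close> a subspace of the rational vector space of all
  functions \<^typ>\<open>rat \<Rightarrow> rat\<close>, with pointwise operations.
\<close>

definition X :: "(rat \<Rightarrow> rat) set" where
  "X = {\<alpha>. \<forall>t. t \<notin> dyadic_unit \<longrightarrow> \<alpha> t = 0}"

definition on_dyadic :: "(rat \<Rightarrow> rat) \<Rightarrow> (rat \<Rightarrow> rat)" where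
  "on_dyadic f = (\<lambda>t. if t \<in> dyadic_unit then f t else 0)"

definition T0 :: "(rat \<Rightarrow> rat) \<Rightarrow> (rat \<Rightarrow> rat)" where
  "T0 \<alpha> = on_dyadic (\<lambda>t. \<alpha> (t / 2))"

definition T1 :: "(rat \<Rightarrow> rat) \<Rightarrow> (rat \<Rightarrow> rat)" where
  "T1 \<alpha> = on_dyadic (\<lambda>t. \<alpha> ((1 + t) / 2))"

definition fun_scale :: "rat \<Rightarrow> (rat \<Rightarrow> rat) \<Rightarrow> (rat \<Rightarrow> rat)" where
  "fun_scale c \<alpha> = (\<lambda>t. c * \<alpha> t)"

global_interpretation qfun: vector_space fun_scale
  by unfold_locales (auto simp: fun_scale_def fun_eq_iff algebra_simps)

definition finite_dim_subspace :: "(rat \<Rightarrow> rat) set \<Rightarrow> bool" where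
  "finite_dim_subspace V \<longleftrightarrow> qfun.subspace V \<and> (\<exists>B. finite B \<and> V = qfun.span B)"

text \<open>The direction of the inequality is the one usually called concave.\<close>

definition convexX :: "(rat \<Rightarrow> rat) \<Rightarrow> bool" where
  "convexX \<alpha> \<longleftrightarrow> (\<forall>(n::nat) (i::int). 0 < i \<and> i < 2 ^ n \<longrightarrow>
     2 * \<alpha> (of_int i / 2 ^ n) \<ge> \<alpha> (of_int (i - 1) / 2 ^ n) + \<alpha> (of_int (i + 1) / 2 ^ n))"

definition lipschitzX :: "(rat \<Rightarrow> rat) \<Rightarrow> bool" where
  "lipschitzX \<alpha> \<longleftrightarrow>
     (\<exists>L. \<forall>s\<in>dyadic_unit. \<forall>t\<in>dyadic_unit. \<bar>\<alpha> s - \<alpha> t\<bar> \<le> L * \<bar>s - t\<bar>)"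


section \<open>The product and the functions \<open>\<phi>\<^sub>m\<close>\<close>

text \<open>The denominator of a dyadic rational \<open>t\<close> is \<open>2 ^ dyadic_exp t\<close>.\<close>

definition dyadic_exp :: "rat \<Rightarrow> nat" where
  "dyadic_exp t = (LEAST k. t * 2 ^ k \<in> \<int>)"

lemma dyadic_unit_0 [simp]: "0 \<in> dyadic_unit" and dyadic_unit_1 [simp]: "1 \<in> dyadic_unit"
  by (auto simp: dyadic_unit_def)

lemma dyadic_exp_0 [simp]: "dyadic_exp 0 = 0" and dyadic_exp_1 [simp]: "dyadic_exp 1 = 0"
  by (auto simp: dyadic_exp_def)

lemma dyadic_exp_double:
  assumes "t \<in> dyadic_unit" "t \<noteq> 0" "t \<noteq> 1"
  shows "0 < dyadic_exp t" "dyadic_exp (2 * t) < dyadic_exp t"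
    "dyadic_exp (2 * t - 1) < dyadic_exp t"
proof -
  let ?k = "dyadic_exp t"
  have k: "t * 2 ^ ?k \<in> \<int>"
  proof -
    from assms(1) have "\<exists>k. t * 2 ^ k \<in> \<int>" by (simp add: dyadic_unit_def)
    then show ?thesis unfolding dyadic_exp_def by (rule LeastI_ex)
  qed
  show pos: "0 < ?k"
  proof (rule ccontr)
    assume "\<not> 0 < ?k"
    then have "?k = 0" by blast
    with k have "t \<in> \<int>" by (simp only: power_0 mult_1_right)
    then obtain z where z: "t = of_int z" by (rule Ints_cases)
    have "0 \<le> z" "z \<le> 1" "z \<noteq> 0" "z \<noteq> 1"
      using assms unfolding dyadic_unit_def z by simp_all
    then show False by linarith
  qed
  then obtain j where j: "?k = Suc j" using gr0_implies_Suc by blast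
  have A: "2 * t * 2 ^ j \<in> \<int>"
    using k unfolding j by (simp only: power_Suc mult_ac)
  have "(2 * t - 1) * 2 ^ j = 2 * t * 2 ^ j - 2 ^ j"
    by (simp only: left_diff_distrib mult_1)
  also have "\<dots> \<in> \<int>"
    using A by (rule Ints_diff) (rule Ints_power, rule Ints_1[THEN Ints_add, OF Ints_1, unfolded one_add_one])
  finally have B: "(2 * t - 1) * 2 ^ j \<in> \<int>" .
  have "dyadic_exp (2 * t) \<le> j"
    unfolding dyadic_exp_def using A by (rule Least_le)
  then show "dyadic_exp (2 * t) < ?k" using j by linarith
  have "dyadic_exp (2 * t - 1) \<le> j"
    unfolding dyadic_exp_def using B by (rule Least_le)
  then show "dyadic_exp (2 * t - 1) < ?k" using j by linarith
qed

function hash :: "(rat \<Rightarrow> rat) \<Rightarrow> (rat \<Rightarrow> rat) \<Rightarrow> rat \<Rightarrow> rat" where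
  "hash \<alpha> \<beta> t =
    (if t \<notin> dyadic_unit \<or> t = 0 then 0
     else if t = 1 then (\<alpha> 1 - \<alpha> 0) * (\<beta> 1 - \<beta> 0)
     else if t \<le> 1/2 then hash (T0 \<alpha>) (T0 \<beta>) (2 * t) + hash (T1 \<alpha>) (T1 \<beta>) (2 * t)
     else hash (T0 \<alpha>) (T0 \<beta>) 1 + hash (T1 \<alpha>) (T1 \<beta>) 1
          + hash (T0 \<alpha>) (T1 \<beta>) (2 * t - 1) + hash (T1 \<alpha>) (T0 \<beta>) (2 * t - 1))"
  by pat_completeness auto
termination
  by (relation "measure (\<lambda>(_, _, t). dyadic_exp t)") (auto simp: dyadic_exp_double)

declare hash.simps [simp del]

definition eps :: "rat \<Rightarrow> rat" where
  "eps = on_dyadic (\<lambda>t. t - t\<^sup>2)"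

function phi :: "nat \<Rightarrow> rat \<Rightarrow> rat" where
  "phi m t =
    (if t \<notin> dyadic_unit \<or> t = 0 \<or> t = 1 then 0
     else if t \<le> 1/2 then
       (if even m then (phi (m + 1) (2 * t) + (8 * of_nat m + 6) * t) / 8
        else (phi (m - 1) (2 * t) + eps (2 * t) + (8 * of_nat m + 6) * t) / 8)
     else
       (if m = 0 then (phi 0 (2 * t - 1) + 6 * (1 - t)) / 8
        else if even m
        then (phi (m - 1) (2 * t - 1) + eps (2 * t - 1) + (8 * of_nat m + 6) * (1 - t)) / 8
        else (phi (m + 1) (2 * t - 1) + (8 * of_nat m + 6) * (1 - t)) / 8))"
  by pat_completeness auto
termination
  by (relation "measure (\<lambda>(_, t). dyadic_exp t)") (auto simp: dyadic_exp_double)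

declare phi.simps [simp del]

text \<open>
  The defining clauses overlap at \<open>t = 0\<close>, \<open>1/2\<close> and \<open>1\<close>; the following lemmas
  show that they are consistent and hold on the full closed half-intervals.
\<close>

lemma hash_0 [simp]: "hash \<alpha> \<beta> 0 = 0"
  and hash_1: "hash \<alpha> \<beta> 1 = (\<alpha> 1 - \<alpha> 0) * (\<beta> 1 - \<beta> 0)"
  by (subst hash.simps; simp)+

lemma hash_left:
  assumes "t \<in> dyadic_unit" "t \<le> 1/2"
  shows "hash \<alpha> \<beta> t = hash (T0 \<alpha>) (T0 \<beta>) (2 * t) + hash (T1 \<alpha>) (T1 \<beta>) (2 * t)"
  using assms by (subst hash.simps) auto

lemma hash_right:
  assumes "t \<in> dyadic_unit" "1/2 \<le> t"
  shows "hash \<alpha> \<beta> t = hash (T0 \<alpha>) (T0 \<beta>) 1 + hash (T1 \<alpha>) (T1 \<beta>) 1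
    + hash (T0 \<alpha>) (T1 \<beta>) (2 * t - 1) + hash (T1 \<alpha>) (T0 \<beta>) (2 * t - 1)"
proof -
  consider "t = 1" | "t = 1/2" | "t \<noteq> 1" "\<not> t \<le> 1/2" using assms(2) by linarith
  then show ?thesis
  proof cases
    case 1
    then show ?thesis
      by (simp add: hash_1 T0_def T1_def on_dyadic_def algebra_simps)
  next
    case 2
    then have "t \<le> 1/2" "2 * t = 1" by simp_all
    with assms(1) show ?thesis by (simp only: hash_left) simp
  next
    case 3
    with assms have "t \<noteq> 0" by auto
    with 3 assms(1) show ?thesis by (subst hash.simps) (simp only: if_False if_True simp_thms)
  qed
qed

lemma hash_in_X: "hash \<alpha> \<beta> \<in> X"
  unfolding X_def by (auto, subst hash.simps, simp)

lemma phi_0 [simp]: "phi m 0 = 0" and phi_1 [simp]: "phi m 1 = 0"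
  by (subst phi.simps; simp)+

lemma phi_left:
  assumes "t \<in> dyadic_unit" "t \<le> 1/2"
  shows "even m \<Longrightarrow> 8 * phi m t = phi (m + 1) (2 * t) + (8 * of_nat m + 6) * t"
    and "odd m \<Longrightarrow> 8 * phi m t = phi (m - 1) (2 * t) + eps (2 * t) + (8 * of_nat m + 6) * t"
proof -
  have "eps 0 = 0" by (simp add: eps_def on_dyadic_def)
  moreover have "t \<noteq> 1" using assms(2) by auto
  ultimately show
    "even m \<Longrightarrow> 8 * phi m t = phi (m + 1) (2 * t) + (8 * of_nat m + 6) * t"
    "odd m \<Longrightarrow> 8 * phi m t = phi (m - 1) (2 * t) + eps (2 * t) + (8 * of_nat m + 6) * t"
    using assms by (cases "t = 0"; simp; subst phi.simps; simp)+
qed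

lemma phi_right:
  assumes "t \<in> dyadic_unit" "1/2 \<le> t"
  shows "8 * phi 0 t = phi 0 (2 * t - 1) + 6 * (1 - t)"
    and "m \<noteq> 0 \<Longrightarrow> even m \<Longrightarrow>
      8 * phi m t = phi (m - 1) (2 * t - 1) + eps (2 * t - 1) + (8 * of_nat m + 6) * (1 - t)"
    and "odd m \<Longrightarrow> 8 * phi m t = phi (m + 1) (2 * t - 1) + (8 * of_nat m + 6) * (1 - t)"
proof -
  have eps: "eps 0 = 0" "eps 1 = 0" by (simp_all add: eps_def on_dyadic_def)
  have mid: "8 * phi k (1/2) = (8 * of_nat k + 6) / 2" for k
  proof -
    have "1/2 \<in> dyadic_unit"
      by (auto simp: dyadic_unit_def intro!: exI[of _ 1])
    then show ?thesis
      using phi_left[of "1/2" k] by (cases "even k") (simp_all add: eps)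
  qed
  consider "t = 1" | "t = 1/2" | "t \<noteq> 0" "t \<noteq> 1" "\<not> t \<le> 1/2"
    using assms(2) by fastforce
  note cs = this
  show "8 * phi 0 t = phi 0 (2 * t - 1) + 6 * (1 - t)"
  proof (cases rule: cs)
    case 1 then show ?thesis by simp
  next
    case 2 show ?thesis unfolding 2 mid by simp
  next
    case 3 then show ?thesis using assms(1) by (subst phi.simps) simp
  qed
  show "8 * phi m t = phi (m - 1) (2 * t - 1) + eps (2 * t - 1) + (8 * of_nat m + 6) * (1 - t)"
    if "m \<noteq> 0" "even m"
  proof (cases rule: cs)
    case 1 then show ?thesis by (simp add: eps)
  next
    case 2 show ?thesis unfolding 2 mid by (simp add: eps)
  next
    case 3 then show ?thesis using assms(1) that by (subst phi.simps) simp
  qed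
  show "8 * phi m t = phi (m + 1) (2 * t - 1) + (8 * of_nat m + 6) * (1 - t)" if "odd m"
  proof (cases rule: cs)
    case 1 then show ?thesis by simp
  next
    case 2 show ?thesis unfolding 2 mid by simp
  next
    case 3
    from that have "m \<noteq> 0" by (auto elim: oddE)
    with 3 that show ?thesis using assms(1) by (subst phi.simps) simp
  qed
qed

lemma phi_in_X: "phi m \<in> X"
  unfolding X_def by (auto, subst phi.simps, simp)


section \<open>The series, the limit, and algebraicity\<close>

definition tX :: "rat \<Rightarrow> rat" where
  "tX = on_dyadic (\<lambda>t. t)"

definition S_series :: "(rat \<Rightarrow> rat) \<Rightarrow> rat fps" where
  "S_series \<alpha> = Abs_fps (\<lambda>n. \<alpha> (1 / 2 ^ n) * 2 ^ n)"

definition mu_seq :: "(rat \<Rightarrow> rat) \<Rightarrow> nat \<Rightarrow> real" where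
  "mu_seq \<alpha> n = 2 ^ n * of_rat (\<alpha> (1 / 2 ^ n))"

text \<open>Meaningful only if \<^term>\<open>convergent (mu_seq \<alpha>)\<close>.\<close>

definition mu :: "(rat \<Rightarrow> rat) \<Rightarrow> real" where
  "mu \<alpha> = lim (mu_seq \<alpha>)"

text \<open>
  The field of rational functions in one variable over the rationals, as a subfield of the field
  of formal Laurent series, into which formal power series embed by \<^const>\<open>fps_to_fls\<close>.
\<close>

definition rat_funs :: "rat fls set" where
  "rat_funs = {fps_to_fls (fps_of_poly a) / fps_to_fls (fps_of_poly b) | a b. b \<noteq> 0}"

definition algebraic_over :: "'a::field set \<Rightarrow> 'a \<Rightarrow> bool" where
  "algebraic_over K x \<longleftrightarrow> (\<exists>p. p \<noteq> 0 \<and> (\<forall>i. coeff p i \<in> K) \<and> poly p x = 0)"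

end

theory Submission
  imports Defs "HOL-Algebra.Algebraic_Closure_Type" "Jordan_Normal_Form.Char_Poly"
begin

text \<open>
  Let \<open>L\<close> be the field of formal Laurent series over the rationals, \<open>K\<close> the subfield of rational
  functions, and \<open>K'\<close> the field of all elements of \<open>L\<close> that are algebraic over \<open>K\<close>.

  \<^bold>\<open>A half-line system.\<close> For \<open>\<alpha>\<close> in the given finite-dimensional space put
  \<open>F\<^sub>m(\<alpha>) = \<Sum>n. (\<alpha> # \<phi>\<^sub>m)(2\<^sup>-\<^sup>n) (2w)\<^sup>n\<close>. At \<open>2\<^sup>-\<^sup>n\<close> only the left halves of the recursions for
  \<open>#\<close> matter, and inserting the recursion for \<open>\<phi>\<^sub>m\<close> expresses \<open>F\<^sub>m\<close> as \<open>w\<close> times a combination of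
  \<open>F\<^sub>m\<^sub>-\<^sub>1\<close> and \<open>F\<^sub>m\<^sub>+\<^sub>1\<close> plus a term that is affine in \<open>m \<ge> 1\<close> for each parity of \<open>m\<close>; for \<open>m = 0\<close>
  the series \<open>F\<^sub>0\<close> itself takes the place of \<open>F\<^sub>m\<^sub>-\<^sub>1\<close>. The coefficients are the matrices of
  \<open>T\<^sub>0\<close> and \<open>T\<^sub>1\<close>, which exchange their roles with the parity of \<open>m\<close>
  (lemma \<open>hash_series_phi\<close>). Grouping \<open>m = 2k\<close> and \<open>m = 2k + 1\<close> gives a system
  \<open>x\<^sub>k = w (P x\<^sub>k\<^sub>+\<^sub>1 + Q x\<^sub>k + S x\<^sub>k\<^sub>-\<^sub>1) + b\<^sub>k\<close> with constant matrices for \<open>k \<ge> 1\<close>, a modified diagonal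
  block at \<open>k = 0\<close>, and \<open>b\<^sub>k\<close> affine in \<open>k \<ge> 1\<close>.

  \<^bold>\<open>Its solution is algebraic\<close> (lemma \<open>toeplitz_solution_algebraic\<close>). The system is infinite, so linear
  algebra over \<open>K\<close> is not enough. Choose a \<open>K'\<close>-linear projection \<open>\<pi>\<close> of \<open>L\<close> onto \<open>K'\<close>. Applied to
  the entries of the solution \<open>x\<close> it produces a second solution. The factor \<open>w\<close> makes the system
  contracting, so a solution whose entries have bounded pole order is unique; hence
  \<open>x = \<pi> x\<close> is algebraic as soon as the entries of \<open>\<pi> x\<close> have bounded pole order. Nothing
  makes \<open>\<pi>\<close> continuous, but on the entries of \<open>x\<close> it can be controlled. By Cramer's
  rule for the symbol of the system, a nonzero polynomial over \<open>K\<close> multiplies the generating function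
  \<open>f = \<Sum>k. x\<^sub>k z\<^sup>k\<close> into a polynomial over \<open>L\<close>. Write \<open>f = N / D\<close> in lowest terms, \<open>D\<close> monic. The
  roots of \<open>D\<close> are algebraic over \<open>K\<close>, so the coefficients of \<open>D\<close> lie in \<open>K'\<close>
  and \<open>\<pi> f = \<pi> N / D\<close>. By Bezout \<open>1 / D\<close> is a polynomial combination \<open>a f + b\<close>, so it inherits
  the bound on pole orders from \<open>f\<close>, and so does \<open>\<pi> f\<close> (lemma \<open>adically_bounded_projection\<close>).

  \<^bold>\<open>The limit.\<close> Concavity of \<open>\<beta>\<^sub>1\<close> and of \<open>\<phi>\<^sub>0\<close> on dyadic intervals makes \<open>2\<^sup>n E\<^sub>1(2\<^sup>-\<^sup>n)\<close>
  nondecreasing, and the Lipschitz bounds make it bounded, so \<open>\<mu>\<close> exists. The series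
  \<open>(1 - w) S(w)\<close> has absolutely summable coefficients with sum \<open>\<mu>\<close>. Evaluating at
  \<open>w = 1\<close> a polynomial relation for it, after cancelling all common factors \<open>1 - w\<close> of the
  coefficients, gives a nontrivial algebraic equation for \<open>\<mu>\<close> (lemma \<open>limit_algebraic\<close>).
\<close>

(* The record-based algebra would otherwise shadow the polynomial type and the constant X. *)
hide_const (open) up_ring.coeff Polynomials.degree Polynomials.lead_coeff Module.smult
no_notation var ("X\<index>")

section \<open>Algebraic elements over a subfield\<close>

text \<open>
  A subfield is given as a set of elements of a field type, since the rational functions and the
  algebraic Laurent series both arise as subsets of \<^typ>\<open>rat fls\<close>.
\<close>

locale subfield_of =
  fixes F :: "'a :: field set"
  assumes one_mem: "1 \<in> F"
    and diff_mem: "x \<in> F \<Longrightarrow> y \<in> F \<Longrightarrow> x - y \<in> F"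
    and mult_mem: "x \<in> F \<Longrightarrow> y \<in> F \<Longrightarrow> x * y \<in> F"
    and inverse_mem: "x \<in> F \<Longrightarrow> inverse x \<in> F"
begin

lemma zero_mem: "0 \<in> F"
  using diff_mem[OF one_mem one_mem] by simp

lemma uminus_mem: "x \<in> F \<Longrightarrow> - x \<in> F"
  using diff_mem[OF zero_mem] by fastforce

lemma add_mem: "x \<in> F \<Longrightarrow> y \<in> F \<Longrightarrow> x + y \<in> F"
  using diff_mem[of x "- y"] uminus_mem by simp

lemma divide_mem: "x \<in> F \<Longrightarrow> y \<in> F \<Longrightarrow> x / y \<in> F"
  by (simp add: divide_inverse mult_mem inverse_mem)

lemma sum_mem: "(\<And>i. i \<in> I \<Longrightarrow> f i \<in> F) \<Longrightarrow> sum f I \<in> F"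
  by (induction I rule: infinite_finite_induct) (auto simp: zero_mem add_mem)

lemma of_nat_mem: "of_nat n \<in> F"
  by (induction n) (auto simp: zero_mem one_mem add_mem)

lemma subfield_ring_of_type: "subfield F (ring_of_type_algebra :: 'a ring)"
proof -
  interpret R: field "ring_of_type_algebra :: 'a ring" by rule
  have [simp]: "a_inv (ring_of_type_algebra :: 'a ring) x = - x" for x
    by (rule R.minus_equality) (auto simp: ring_of_type_algebra_def)
  have [simp]: "m_inv (ring_of_type_algebra :: 'a ring) x = inverse x" if "x \<noteq> 0" for x
    by (rule R.comm_inv_char) (use that in \<open>auto simp: ring_of_type_algebra_def\<close>)
  show ?thesis
  proof (rule R.subfieldI'[OF R.subringI])
    fix k assume k: "k \<in> F - {\<zero>\<^bsub>(ring_of_type_algebra :: 'a ring)\<^esub>}"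
    then have "k \<noteq> 0" by (simp add: ring_of_type_algebra_def)
    then show "m_inv (ring_of_type_algebra :: 'a ring) k \<in> F" 
      using k by (simp add: inverse_mem)
  qed (simp_all add: uminus_mem, simp_all add: ring_of_type_algebra_def one_mem mult_mem add_mem)
qed

text \<open>
  The bridge to the record-based ring theory, whose polynomials are coefficient lists with the leading
  coefficient first.
\<close>

lemma algebraic_over_iff_ring:
  "algebraic_over F x \<longleftrightarrow> (ring.algebraic (ring_of_type_algebra :: 'a ring) over F) x"
proof -
  let ?R = "ring_of_type_algebra :: 'a ring"
  interpret R: field ?R by rule
  have sub: "subfield F ?R" by (rule subfield_ring_of_type)
  have pow: "x [^]\<^bsub>?R\<^esub> n = x ^ n" for x and n :: nat
    by (induction n) (simp_all, simp_all add: ring_of_type_algebra_def mult.commute)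
  have eval: "R.eval xs x = poly (Poly (rev xs)) x" for xs
    by (induction xs) (simp_all add: pow Poly_append poly_monom, simp_all add: ring_of_type_algebra_def mult.commute add.commute)
  have zero: "\<zero>\<^bsub>?R\<^esub> = 0" by (simp add: ring_of_type_algebra_def)
  show ?thesis
  proof
    assume "algebraic_over F x"
    then obtain p where p: "p \<noteq> 0" "\<And>i. coeff p i \<in> F" "poly p x = 0"
      unfolding algebraic_over_def by blast
    have "set (coeffs p) \<subseteq> F" using p(2) by (auto simp: coeffs_def)
    then have "rev (coeffs p) \<in> carrier (univ_poly ?R F)"
      using p(1) by (auto simp: univ_poly_def polynomial_def hd_rev last_coeffs_eq_coeff_degree zero)
    moreover have "rev (coeffs p) \<noteq> []" using p(1) by simp
    ultimately show "(R.algebraic over F) x"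
      by (rule R.algebraicI) (simp add: eval p(3) zero)
  next
    assume "(R.algebraic over F) x"
    moreover have "x \<in> carrier ?R" by (simp add: ring_of_type_algebra_def)
    ultimately obtain xs where xs: "xs \<in> carrier (univ_poly ?R F)" "xs \<noteq> []" "R.eval xs x = 0"
      using R.algebraicE[of F x] sub zero subfieldE(1) by metis
    have "set xs \<subseteq> F" "hd xs \<noteq> 0"
      using xs(1,2) by (auto simp: univ_poly_def polynomial_def zero)
    then have "coeff (Poly (rev xs)) i \<in> F" for i
      by (auto simp: nth_default_def zero_mem rev_nth subset_iff)
    moreover have "coeff (Poly (rev xs)) (length xs - 1) \<noteq> 0"
      using \<open>hd xs \<noteq> 0\<close> xs(2) by (simp add: nth_default_def rev_nth hd_conv_nth)
    then have "Poly (rev xs) \<noteq> 0" by force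
    ultimately show "algebraic_over F x"
      unfolding algebraic_over_def using xs(3) by (auto simp: eval)
  qed
qed

lemma subfield_algebraic_over: "subfield_of {x. algebraic_over F x}"
proof -
  let ?R = "ring_of_type_algebra :: 'a ring"
  interpret R: field ?R by rule
  let ?A = "{x. algebraic_over F x}"
  have "?A = {x \<in> carrier ?R. (R.algebraic over F) x}"
    by (auto simp: algebraic_over_iff_ring ring_of_type_algebra_def)
  then have A: "subfield ?A ?R"
    using R.subfield_of_algebraics[OF subfield_ring_of_type] by simp
  have um: "a_inv ?R x = - x" for x
    by (rule R.minus_equality) (auto simp: ring_of_type_algebra_def)
  have inv: "m_inv ?R x = inverse x" if "x \<noteq> 0" for x
    by (rule R.comm_inv_char) (use that in \<open>auto simp: ring_of_type_algebra_def\<close>)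
  have z: "\<zero>\<^bsub>?R\<^esub> = 0" by (simp add: ring_of_type_algebra_def)
  note sr = subringE[OF subfieldE(1)[OF A]]
  show ?thesis
  proof
    show "1 \<in> ?A" using sr(3) by (simp add: ring_of_type_algebra_def)
  next
    fix x y assume xy: "x \<in> ?A" "y \<in> ?A"
    show "x * y \<in> ?A" using sr(6)[OF xy] by (simp add: ring_of_type_algebra_def)
    have "- y \<in> ?A" using sr(5)[OF xy(2)] unfolding um .
    from sr(7)[OF xy(1) this] show "x - y \<in> ?A" by (simp add: ring_of_type_algebra_def)
  next
    fix x assume x: "x \<in> ?A"
    show "inverse x \<in> ?A"
    proof (cases "x = 0")
      case False
      then show ?thesis using R.subfield_m_inv(1)[OF A, of x] x inv[OF False] z by auto
    qed (use x in simp)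
  qed
qed

lemma algebraic_over_self: "x \<in> F \<Longrightarrow> algebraic_over F x"
  unfolding algebraic_over_def
  by (rule exI[of _ "[:- x, 1:]"]) (auto simp: coeff_pCons uminus_mem one_mem zero_mem split: nat.splits)

end

context subfield_of
begin

definition polys :: "'a poly set" where
  "polys = {p. \<forall>i. coeff p i \<in> F}"

lemma polys_0: "0 \<in> polys" and polys_1: "1 \<in> polys"
  by (auto simp: polys_def zero_mem one_mem coeff_1)

lemma polys_const: "c \<in> F \<Longrightarrow> [:c:] \<in> polys"
  by (auto simp: polys_def zero_mem coeff_pCons split: nat.splits)

lemma polys_pCons: "c \<in> F \<Longrightarrow> p \<in> polys \<Longrightarrow> pCons c p \<in> polys"
  by (auto simp: polys_def coeff_pCons split: nat.splits)

lemma polys_add: "p \<in> polys \<Longrightarrow> q \<in> polys \<Longrightarrow> p + q \<in> polys"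
  by (auto simp: polys_def add_mem)

lemma polys_uminus: "p \<in> polys \<Longrightarrow> - p \<in> polys"
  by (auto simp: polys_def uminus_mem)

lemma polys_mult: "p \<in> polys \<Longrightarrow> q \<in> polys \<Longrightarrow> p * q \<in> polys"
  by (auto simp: polys_def coeff_mult intro!: sum_mem mult_mem)

lemma polys_sum: "(\<And>i. i \<in> I \<Longrightarrow> f i \<in> polys) \<Longrightarrow> sum f I \<in> polys"
  by (induction I rule: infinite_finite_induct) (auto simp: polys_0 polys_add)

lemma polys_prod: "(\<And>i. i \<in> I \<Longrightarrow> f i \<in> polys) \<Longrightarrow> prod f I \<in> polys"
  by (induction I rule: infinite_finite_induct) (auto simp: polys_1 polys_mult)

lemma polys_prod_mset: "(\<And>x. x \<in># A \<Longrightarrow> f x \<in> polys) \<Longrightarrow> (\<Prod>x\<in>#A. f x) \<in> polys"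
  by (induction A) (auto simp: polys_1 polys_mult)

lemma polys_det:
  assumes A: "A \<in> carrier_mat n n" and "\<And>i j. i < n \<Longrightarrow> j < n \<Longrightarrow> A $$ (i, j) \<in> polys"
  shows "det A \<in> polys"
  unfolding det_def'[OF A]
proof (intro polys_sum polys_mult polys_prod)
  fix p i assume "p \<in> {p. p permutes {0..<n}}" "i \<in> {0..<n}"
  then show "A $$ (i, p i) \<in> polys"
    using assms(2)[of i "p i"] by (auto simp: permutes_def)
next
  fix p show "signof p \<in> polys"
    using polys_uminus[OF polys_1] by (simp add: polys_1 sign_def)
qed

end

text \<open>
  Over an algebraic closure \<open>D\<close> is a product of linear factors \<open>z - \<rho>\<close> where each \<open>\<rho>\<close> is a
  root of \<open>P\<close>. The coefficients of \<open>D\<close> are polynomials in these \<open>\<rho>\<close>, and the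
  algebraic elements form a field.
\<close>

lemma coeff_monic_dvd_algebraic_over:
  fixes F :: "'a :: field set"
  assumes F: "subfield_of F" and P: "P \<noteq> 0" "\<And>i. coeff P i \<in> F"
    and D: "D dvd P" "lead_coeff D = 1"
  shows "algebraic_over F (coeff D i)"
proof -
  interpret subfield_of F by fact
  interpret to_ac: inj_idom_hom "to_ac :: 'a \<Rightarrow> 'a alg_closure"
    by unfold_locales auto
  interpret to_ac_poly: map_poly_inj_idom_hom "to_ac :: 'a \<Rightarrow> 'a alg_closure" ..
  let ?G = "to_ac ` F"
  interpret G: subfield_of ?G
  proof
    show "1 \<in> ?G" using one_mem to_ac_1 by (metis image_eqI)
    fix x y assume "x \<in> ?G" "y \<in> ?G"
    then obtain a b where ab: "x = to_ac a" "y = to_ac b" "a \<in> F" "b \<in> F" by auto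
    show "x - y \<in> ?G" unfolding ab by (rule image_eqI[of _ _ "a - b"]) (simp_all add: diff_mem ab)
    show "x * y \<in> ?G" unfolding ab by (rule image_eqI[of _ _ "a * b"]) (simp_all add: mult_mem ab)
    show "inverse x \<in> ?G" unfolding ab by (rule image_eqI[of _ _ "inverse a"]) (simp_all add: inverse_mem ab)
  qed
  interpret A: subfield_of "{x. algebraic_over ?G x}"
    by (rule G.subfield_algebraic_over)
  let ?D = "map_poly to_ac D"
  have D0: "D \<noteq> 0" using D(2) by auto
  have lc: "lead_coeff ?D = 1" by (simp add: D(2))
  from alg_closed_imp_factorization[of ?D] D0 lc
  obtain R where R: "?D = (\<Prod>x\<in>#R. [:-x, 1:])" by auto
  have "algebraic_over ?G x" if "x \<in># R" for x
  proof -
    have "[:-x, 1:] dvd ?D" unfolding R using that by (simp add: dvd_prod_mset)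
    also have "?D dvd map_poly to_ac P" using D(1) by (auto elim!: dvdE simp: to_ac_poly.hom_mult)
    finally have "poly (map_poly to_ac P) x = 0" by (simp add: poly_eq_0_iff_dvd)
    then show ?thesis unfolding algebraic_over_def using P
      by (intro exI[of _ "map_poly to_ac P"]) auto
  qed
  then have "?D \<in> A.polys"
    unfolding R using A.one_mem by (intro A.polys_prod_mset A.polys_pCons A.polys_const A.uminus_mem) simp_all
  then have "algebraic_over ?G (to_ac (coeff D i))" by (auto simp: A.polys_def)
  then obtain q where q: "q \<noteq> 0" "\<And>i. coeff q i \<in> ?G" "poly q (to_ac (coeff D i)) = 0"
    unfolding algebraic_over_def by blast
  define r where "r = map_poly of_ac q"
  have ofac: "to_ac (of_ac (coeff q i)) = coeff q i" for i
    using q(2)[of i] by (intro to_ac_of_ac) auto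
  have qr: "q = map_poly to_ac r"
    by (rule poly_eqI) (simp add: r_def coeff_map_poly ofac)
  show ?thesis unfolding algebraic_over_def
  proof (intro exI[of _ r] conjI allI)
    show "r \<noteq> 0" using q(1) qr by auto
    show "coeff r i \<in> F" for i using q(2)[of i] unfolding qr by auto
    show "poly r (coeff D i) = 0" using q(3) unfolding qr by simp
  qed
qed

abbreviation ratfun_of_poly :: "rat poly \<Rightarrow> rat fls" where
  "ratfun_of_poly p \<equiv> fps_to_fls (fps_of_poly p)"

lemma ratfun_of_poly_mult: "ratfun_of_poly (p * q) = ratfun_of_poly p * ratfun_of_poly q"
  by (simp add: fps_of_poly_mult fls_times_fps_to_fls)

lemma ratfun_of_poly_diff: "ratfun_of_poly (p - q) = ratfun_of_poly p - ratfun_of_poly q"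
  by (simp add: fps_of_poly_diff)

interpretation rat_funs: subfield_of rat_funs
proof
  show "1 \<in> rat_funs" unfolding rat_funs_def by (auto intro!: exI[of _ 1])
next
  fix x y assume "x \<in> rat_funs" "y \<in> rat_funs"
  then obtain a b c d where x: "x = ratfun_of_poly a / ratfun_of_poly b" "b \<noteq> 0"
    and y: "y = ratfun_of_poly c / ratfun_of_poly d" "d \<noteq> 0"
    unfolding rat_funs_def by blast
  have bd: "b * d \<noteq> 0" using x(2) y(2) by simp
  have "x - y = ratfun_of_poly (a * d - c * b) / ratfun_of_poly (b * d)"
    unfolding x(1) y(1) ratfun_of_poly_mult ratfun_of_poly_diff
    by (rule diff_frac_eq) (use x(2) y(2) in auto)
  then show "x - y \<in> rat_funs" unfolding rat_funs_def using bd by blast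
  have "x * y = ratfun_of_poly (a * c) / ratfun_of_poly (b * d)"
    unfolding x(1) y(1) ratfun_of_poly_mult by simp
  then show "x * y \<in> rat_funs" unfolding rat_funs_def using bd by blast
next
  fix x assume "x \<in> rat_funs"
  then obtain a b where x: "x = ratfun_of_poly a / ratfun_of_poly b" "b \<noteq> 0"
    unfolding rat_funs_def by blast
  show "inverse x \<in> rat_funs"
  proof (cases "a = 0")
    case True
    then have "inverse x = ratfun_of_poly 0 / ratfun_of_poly 1" using x by simp
    then show ?thesis unfolding rat_funs_def using one_neq_zero by blast
  next
    case False
    have "inverse x = ratfun_of_poly b / ratfun_of_poly a" unfolding x(1) by simp
    with False show ?thesis unfolding rat_funs_def by blast
  qed
qed

lemma ratfun_of_poly_rat_funs: "ratfun_of_poly p \<in> rat_funs"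
proof -
  have "ratfun_of_poly p = ratfun_of_poly p / ratfun_of_poly 1" by simp
  then show ?thesis unfolding rat_funs_def using one_neq_zero by blast
qed

lemma fls_const_rat_funs: "fls_const c \<in> rat_funs"
  using ratfun_of_poly_rat_funs[of "[:c:]"] by (simp add: fps_of_poly_const)

lemma fls_X_rat_funs: "fls_X \<in> rat_funs"
  using ratfun_of_poly_rat_funs[of "[:0, 1:]"] by (simp add: fps_of_poly_pCons)

section \<open>Algebraic Laurent series\<close>

text \<open>
  The field of algebraic Laurent series is made a type so that it can act as the scalar field
  of a vector space.
\<close>

typedef alg_laurent = "{x. algebraic_over rat_funs x}"
  using rat_funs.algebraic_over_self rat_funs.one_mem by blast

setup_lifting type_definition_alg_laurent

interpretation alg_laurent: subfield_of "{x. algebraic_over rat_funs x}"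
  by (rule rat_funs.subfield_algebraic_over)

instantiation alg_laurent :: field
begin

lift_definition zero_alg_laurent :: alg_laurent is 0
  using alg_laurent.zero_mem by simp
lift_definition one_alg_laurent :: alg_laurent is 1
  using alg_laurent.one_mem by simp
lift_definition plus_alg_laurent :: "alg_laurent \<Rightarrow> alg_laurent \<Rightarrow> alg_laurent" is "(+)"
  using alg_laurent.add_mem by simp
lift_definition minus_alg_laurent :: "alg_laurent \<Rightarrow> alg_laurent \<Rightarrow> alg_laurent" is "(-)"
  using alg_laurent.diff_mem by simp
lift_definition uminus_alg_laurent :: "alg_laurent \<Rightarrow> alg_laurent" is "uminus"
  using alg_laurent.uminus_mem by simp
lift_definition times_alg_laurent :: "alg_laurent \<Rightarrow> alg_laurent \<Rightarrow> alg_laurent" is "(*)"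
  using alg_laurent.mult_mem by simp
lift_definition inverse_alg_laurent :: "alg_laurent \<Rightarrow> alg_laurent" is inverse
  using alg_laurent.inverse_mem by simp
lift_definition divide_alg_laurent :: "alg_laurent \<Rightarrow> alg_laurent \<Rightarrow> alg_laurent" is "(/)"
  using alg_laurent.divide_mem by simp

instance
  by standard (transfer; simp add: field_simps; fail)+

end

text \<open>
  Extend the element 1 to a basis of the Laurent series over the algebraic ones, and let the projection
  be a linear functional with value 1 there.
\<close>

lemma exists_algebraic_projection:
  obtains \<pi> :: "rat fls \<Rightarrow> rat fls"
  where "\<And>x. algebraic_over rat_funs (\<pi> x)"
    and "\<And>x y. \<pi> (x + y) = \<pi> x + \<pi> y"
    and "\<And>c x. algebraic_over rat_funs c \<Longrightarrow> \<pi> (c * x) = c * \<pi> x"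
    and "\<And>c. algebraic_over rat_funs c \<Longrightarrow> \<pi> c = c"
proof -
  interpret vs: vector_space_pair "\<lambda>c x. Rep_alg_laurent c * x" "(*) :: alg_laurent \<Rightarrow> _"
    by unfold_locales
       (simp_all add: algebra_simps plus_alg_laurent.rep_eq times_alg_laurent.rep_eq one_alg_laurent.rep_eq)
  have "vs.vs1.independent {1 :: rat fls}" by (simp add: vs.vs1.independent_insert)
  then obtain g where g: "Vector_Spaces.linear (\<lambda>c x. Rep_alg_laurent c * x) (*) g" "g 1 = 1"
    using vs.linear_independent_extend[of "{1}" "\<lambda>_. 1"] by auto
  interpret g: Vector_Spaces.linear "\<lambda>c x. Rep_alg_laurent c * x" "(*) :: alg_laurent \<Rightarrow> _" g by fact
  define \<pi> where "\<pi> = Rep_alg_laurent \<circ> g"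
  have scale: "\<pi> (c * x) = c * \<pi> x" if "algebraic_over rat_funs c" for c x
    using g.scale[of "Abs_alg_laurent c" x] that
    by (simp add: \<pi>_def Abs_alg_laurent_inverse times_alg_laurent.rep_eq)
  have "\<pi> 1 = 1" by (simp add: \<pi>_def g(2) one_alg_laurent.rep_eq)
  with scale[of _ 1] have "\<pi> c = c" if "algebraic_over rat_funs c" for c
    using that by simp
  moreover have "\<pi> (x + y) = \<pi> x + \<pi> y" for x y
    by (simp add: \<pi>_def g.add plus_alg_laurent.rep_eq)
  moreover have "algebraic_over rat_funs (\<pi> x)" for x
    using Rep_alg_laurent[of "g x"] by (simp add: \<pi>_def)
  ultimately show thesis using scale that by blast
qed

section \<open>Rational generating functions and projections\<close>

text \<open>
  A nonzero element of least degree divides all others, since remainders stay in the ideal.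
\<close>

lemma poly_ideal_generator:
  fixes I :: "'a :: field poly set"
  assumes "p \<in> I" "p \<noteq> 0" and closed: "\<And>p q r. p \<in> I \<Longrightarrow> q \<in> I \<Longrightarrow> p - r * q \<in> I"
  obtains g where "g \<in> I" "g \<noteq> 0" "\<And>q. q \<in> I \<Longrightarrow> g dvd q"
proof -
  obtain g where g: "g \<in> I" "g \<noteq> 0" and min: "\<And>q. q \<in> I \<Longrightarrow> q \<noteq> 0 \<Longrightarrow> degree g \<le> degree q"
    using ex_has_least_nat[of "\<lambda>q. q \<in> I \<and> q \<noteq> 0" p degree] assms(1,2) by blast
  have "g dvd q" if "q \<in> I" for q
  proof (rule ccontr)
    assume "\<not> g dvd q"
    then have "q mod g \<noteq> 0" by (simp add: dvd_eq_mod_eq_0)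
    moreover have "q mod g \<in> I"
      using closed[OF that g(1), of "q div g"] by (simp add: minus_div_mult_eq_mod)
    ultimately show False
      using min[of "q mod g"] degree_mod_less[OF g(2), of q] by linarith
  qed
  with g show thesis by (rule that)
qed

text \<open>
  \<open>D\<close> generates the ideal of all denominators of \<open>x\<close>. The ideal generated by \<open>D\<close> and the
  numerator \<open>N = D x\<close> contains 1, for a common factor of the two could be cancelled
  to give a smaller denominator. Dividing the resulting Bezout identity by \<open>D\<close> shows that \<open>1 / D\<close> is a
  polynomial combination of \<open>x\<close> and 1.
\<close>

lemma rational_fps_lowest_terms:
  fixes x :: "'a :: field fps"
  assumes "P \<noteq> 0" "fps_of_poly P * x = fps_of_poly M"
  obtains D N a b where "D dvd P" "lead_coeff D = 1" "fps_of_poly D * x = fps_of_poly N"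
    "fps_of_poly D * (fps_of_poly a * x + fps_of_poly b) = 1"
proof -
  define J where "J = {p. \<exists>q. fps_of_poly p * x = fps_of_poly q}"
  have J: "p - r * q \<in> J" if "p \<in> J" "q \<in> J" for p q r
  proof -
    from that obtain p' q' where "fps_of_poly p * x = fps_of_poly p'" "fps_of_poly q * x = fps_of_poly q'"
      unfolding J_def by blast
    then have "fps_of_poly (p - r * q) * x = fps_of_poly (p' - r * q')"
      by (simp add: fps_of_poly_diff fps_of_poly_mult algebra_simps)
    then show ?thesis unfolding J_def by blast
  qed
  \<comment> \<open>\<open>D0\<close> generates the ideal of denominators of \<open>x\<close>; \<open>D\<close> is its monic multiple.\<close>
  obtain D0 where D0: "D0 \<in> J" "D0 \<noteq> 0" "\<And>q. q \<in> J \<Longrightarrow> D0 dvd q"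
    using poly_ideal_generator[of P J, OF _ assms(1) J] assms(2) by (auto simp: J_def)
  define D where "D = smult (inverse (lead_coeff D0)) D0"
  have D: "lead_coeff D = 1" "D \<noteq> 0" using D0(2) by (auto simp: D_def)
  have "D \<in> J"
    using J[OF D0(1) D0(1), of "1 - [:inverse (lead_coeff D0):]"] by (simp add: D_def algebra_simps)
  then obtain N where N: "fps_of_poly D * x = fps_of_poly N" unfolding J_def by blast
  have D_dvd: "D dvd q" if "q \<in> J" for q
    using D0(3)[OF that] D0(2) by (simp add: D_def smult_dvd)
  define I where "I = {a * N + b * D | a b. True}"
  have I: "p - r * q \<in> I" if "p \<in> I" "q \<in> I" for p q r
  proof -
    from that obtain a b a' b' where "p = a * N + b * D" "q = a' * N + b' * D"
      unfolding I_def by blast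
    then have "p - r * q = (a - r * a') * N + (b - r * b') * D" by (simp add: algebra_simps)
    then show ?thesis unfolding I_def by blast
  qed
  have "D = 0 * N + 1 * D" "N = 1 * N + 0 * D" by simp_all
  then have DN: "D \<in> I" "N \<in> I" unfolding I_def by blast+
  obtain g where g: "g \<in> I" "g \<noteq> 0" "\<And>q. q \<in> I \<Longrightarrow> g dvd q"
    using poly_ideal_generator[of D I, OF DN(1) D(2) I] by blast
  obtain d n where dn: "D = g * d" "N = g * n"
    using g(3)[OF DN(1)] g(3)[OF DN(2)] by (auto elim!: dvdE)
  have "fps_of_poly g * (fps_of_poly d * x - fps_of_poly n) = 0"
    using N by (simp add: dn fps_of_poly_mult algebra_simps)
  then have "d \<in> J" using g(2) by (auto simp: J_def)
  then have "g * d dvd d" using D_dvd dn(1) by simp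
  moreover have "d \<noteq> 0" using D(2) dn(1) by auto
  ultimately have "g dvd 1"
    by (metis dvd_mult_cancel_right mult_1)
  then obtain h where h: "1 = g * h" by (elim dvdE)
  from g(1) obtain a b where ab: "g = a * N + b * D" unfolding I_def by blast
  have "fps_of_poly D * (fps_of_poly (h * a) * x + fps_of_poly (h * b))
      = fps_of_poly (h * a) * (fps_of_poly D * x) + fps_of_poly (h * b) * fps_of_poly D"
    by (simp add: algebra_simps)
  also have "\<dots> = fps_of_poly (h * (a * N + b * D))"
    unfolding N by (simp add: fps_of_poly_mult fps_of_poly_add algebra_simps)
  also have "\<dots> = 1" using h by (simp add: ab mult.commute flip: fps_of_poly_1)
  finally show thesis
    using that[OF D_dvd D(1) N, of "h * a" "h * b"] assms(2) by (auto simp: J_def)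
qed

text \<open>
  The \<open>w\<close>-adic valuation of \<open>x\<close> is at least \<open>n\<close>. Unlike \<^const>\<open>fls_subdegree\<close>, which is 0 at the zero
  series, this predicate is closed under sums for every \<open>n\<close>.
\<close>

definition order_ge :: "int \<Rightarrow> rat fls \<Rightarrow> bool" where
  "order_ge n x \<longleftrightarrow> (\<forall>j<n. fls_nth x j = 0)"

lemma order_ge_0 [simp]: "order_ge n 0"
  by (simp add: order_ge_def)

lemma order_ge_add: "order_ge n x \<Longrightarrow> order_ge n y \<Longrightarrow> order_ge n (x + y)"
  by (simp add: order_ge_def)

lemma order_ge_diff: "order_ge n x \<Longrightarrow> order_ge n y \<Longrightarrow> order_ge n (x - y)"
  by (simp add: order_ge_def)

lemma order_ge_sum: "(\<And>i. i \<in> I \<Longrightarrow> order_ge n (f i)) \<Longrightarrow> order_ge n (sum f I)"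
  by (induction I rule: infinite_finite_induct) (auto simp: order_ge_add)

lemma order_ge_mono: "order_ge n x \<Longrightarrow> m \<le> n \<Longrightarrow> order_ge m x"
  by (simp add: order_ge_def)

lemma order_ge_subdegree: "order_ge (fls_subdegree x) x"
  by (simp add: order_ge_def)

lemma order_ge_mult: 
  assumes "order_ge m x" "order_ge n y"
  shows "order_ge (m + n) (x * y)"
proof (cases "x = 0 \<or> y = 0")
  case False
  then have "m \<le> fls_subdegree x" "n \<le> fls_subdegree y"
    using assms by (auto simp: order_ge_def intro!: fls_subdegree_geI)
  then show ?thesis by (auto simp: order_ge_def intro!: fls_times_nth_eq0)
qed auto

lemma order_ge_fps_to_fls: "order_ge 0 (fps_to_fls f)"
  by (simp add: order_ge_def)

lemma order_ge_const: "order_ge 0 (fls_const c)"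
  by (simp add: order_ge_def)

lemma order_ge_X: "order_ge 1 fls_X"
  by (simp add: order_ge_def)

lemma order_ge_all_imp_0: "(\<And>n. order_ge (int n) x) \<Longrightarrow> x = 0"
proof (rule ccontr)
  assume *: "\<And>n. order_ge (int n) x" and "x \<noteq> 0"
  then have "fls_nth x (fls_subdegree x) \<noteq> 0" by simp
  moreover have "fls_subdegree x < int (nat (fls_subdegree x + 1))" by simp
  ultimately show False using *[of "nat (fls_subdegree x + 1)"] unfolding order_ge_def by blast
qed

definition adically_bounded :: "rat fls fps \<Rightarrow> bool" where
  "adically_bounded f \<longleftrightarrow> (\<exists>c. \<forall>k. order_ge c (fps_nth f k))"

lemma adically_bounded_add:
  assumes "adically_bounded f" "adically_bounded g"
  shows "adically_bounded (f + g)"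
proof -
  obtain c d where "order_ge c (fps_nth f k)" "order_ge d (fps_nth g k)" for k
    using assms unfolding adically_bounded_def by blast
  then have "order_ge (min c d) (fps_nth (f + g) k)" for k
    by (auto intro!: order_ge_add intro: order_ge_mono[of c _ "min c d"] order_ge_mono[of d _ "min c d"])
  then show ?thesis unfolding adically_bounded_def by blast
qed

lemma adically_bounded_mult:
  assumes "adically_bounded f" "adically_bounded g"
  shows "adically_bounded (f * g)"
proof -
  obtain c d where "order_ge c (fps_nth f k)" "order_ge d (fps_nth g k)" for k
    using assms unfolding adically_bounded_def by blast
  then have "order_ge (c + d) (fps_nth (f * g) k)" for k
    unfolding fps_mult_nth by (intro order_ge_sum order_ge_mult)
  then show ?thesis unfolding adically_bounded_def by blast
qed

lemma adically_bounded_poly: "adically_bounded (fps_of_poly p)"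
proof (induction p)
  case 0
  then show ?case by (auto simp: adically_bounded_def)
next
  case (pCons a p)
  have "order_ge (fls_subdegree a) (fps_nth (fps_const a) k)" for k
    by (simp add: order_ge_subdegree)
  then have 1: "adically_bounded (fps_const a)" unfolding adically_bounded_def by blast
  have "order_ge 0 (fps_nth fps_X k :: rat fls)" for k
    by (simp add: fps_X_nth order_ge_def)
  then have 2: "adically_bounded fps_X" unfolding adically_bounded_def by blast
  show ?case unfolding fps_of_poly_pCons
    by (intro adically_bounded_add adically_bounded_mult 1 2 pCons)
qed

text \<open>
  With \<open>f = N / D\<close> in lowest terms, the coefficients of \<open>D\<close> are algebraic and may be pulled out of \<open>\<pi>\<close>,
  so \<open>\<pi> f = \<pi> N / D\<close>; and \<open>1 / D\<close> is bounded because it is a polynomial combination of \<open>f\<close> and 1.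
  Only finitely many values of \<open>\<pi>\<close>, those on the coefficients of \<open>N\<close>, enter the bound.
\<close>

lemma adically_bounded_projection:
  assumes add: "\<And>x y. \<pi> (x + y) = \<pi> x + \<pi> y"
    and scale: "\<And>c x. algebraic_over rat_funs c \<Longrightarrow> \<pi> (c * x) = c * \<pi> x"
    and f: "adically_bounded f"
    and P: "P \<noteq> 0" "P \<in> rat_funs.polys" "fps_of_poly P * f = fps_of_poly M"
  shows "adically_bounded (Abs_fps (\<lambda>k. \<pi> (fps_nth f k)))" (is "adically_bounded ?g")
proof -
  obtain D N a b where D: "D dvd P" "lead_coeff D = 1" "fps_of_poly D * f = fps_of_poly N"
    "fps_of_poly D * (fps_of_poly a * f + fps_of_poly b) = 1"
    using rational_fps_lowest_terms[OF P(1,3)] by blast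
  have alg: "algebraic_over rat_funs (coeff D i)" for i
    using coeff_monic_dvd_algebraic_over[OF rat_funs.subfield_of_axioms P(1) _ D(1,2)] P(2)
    by (simp add: rat_funs.polys_def)
  have pi0: "\<pi> 0 = 0" using add[of 0 0] by simp
  then have pi_sum: "\<pi> (sum h I) = (\<Sum>i\<in>I. \<pi> (h i))" for h and I :: "nat set"
    by (induction I rule: infinite_finite_induct) (simp_all add: add)
  have "fps_nth (fps_of_poly D * ?g) k = fps_nth (fps_of_poly (map_poly \<pi> N)) k" for k
  proof -
    have "fps_nth (fps_of_poly D * ?g) k = \<pi> (fps_nth (fps_of_poly D * f) k)"
      by (simp add: fps_mult_nth pi_sum scale alg)
    then show ?thesis unfolding D(3) by (simp add: coeff_map_poly pi0)
  qed
  then have Dg: "fps_of_poly D * ?g = fps_of_poly (map_poly \<pi> N)" by (rule fps_ext)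
  have "?g = (fps_of_poly D * (fps_of_poly a * f + fps_of_poly b)) * ?g" unfolding D(4) by simp
  also have "\<dots> = fps_of_poly (map_poly \<pi> N) * (fps_of_poly a * f + fps_of_poly b)"
    unfolding Dg[symmetric] by (simp only: mult_ac)
  finally have "?g = fps_of_poly (map_poly \<pi> N) * (fps_of_poly a * f + fps_of_poly b)" .
  moreover have "adically_bounded \<dots>"
    by (intro adically_bounded_mult adically_bounded_add adically_bounded_poly f)
  ultimately show ?thesis by simp
qed

section \<open>Half-line systems with constant blocks\<close>

lemma adically_bounded_uniform:
  fixes N :: nat
  assumes "\<And>i. i < N \<Longrightarrow> adically_bounded (f i)"
  shows "\<exists>c. \<forall>i<N. \<forall>k. order_ge c (fps_nth (f i) k)"
  using assms
proof (induction N)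
  case (Suc N)
  have "\<exists>c. \<forall>i<N. \<forall>k. order_ge c (fps_nth (f i) k)"
    by (rule Suc.IH) (simp add: Suc.prems)
  then obtain c where c: "\<And>i k. i < N \<Longrightarrow> order_ge c (fps_nth (f i) k)" by blast
  from Suc.prems[of N] obtain d where d: "\<And>k. order_ge d (fps_nth (f N) k)"
    by (auto simp: adically_bounded_def)
  have "order_ge (min c d) (fps_nth (f i) k)" if "i < Suc N" for i k
  proof (cases "i = N")
    case True
    then show ?thesis using order_ge_mono[OF d[of k], of "min c d"] by simp
  next
    case False
    then have "i < N" using that by simp
    from order_ge_mono[OF c[OF this, of k], of "min c d"] show ?thesis by simp
  qed
  then show ?case by blast
qed auto

text \<open>
  A lower bound on the valuations of all entries that improves itself is no bound at all, so every entry
  is divisible by arbitrarily high powers of \<open>w\<close>.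
\<close>

lemma adic_contraction_imp_0:
  fixes N :: nat
  assumes base: "\<And>k i. i < N \<Longrightarrow> order_ge c (u k i)"
    and step: "\<And>n. (\<And>k i. i < N \<Longrightarrow> order_ge n (u k i)) \<Longrightarrow> (\<And>k i. i < N \<Longrightarrow> order_ge (n + 1) (u k i))"
    and "i < N"
  shows "u k i = 0"
proof (rule order_ge_all_imp_0)
  fix n
  have "\<forall>k i. i < N \<longrightarrow> order_ge (c + int m) (u k i)" for m
  proof (induction m)
    case (Suc m)
    then have "\<forall>k i. i < N \<longrightarrow> order_ge (c + int m + 1) (u k i)" using step[of "c + int m"] by blast
    moreover have "c + int m + 1 = c + int (Suc m)" by simp
    ultimately show ?case by metis
  qed (simp add: base)
  then have "order_ge (c + int (nat (int n - c))) (u k i)" using assms(3) by blast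
  then show "order_ge (int n) (u k i)" by (rule order_ge_mono) linarith
qed

text \<open>
  Row \<open>k\<close> of a block tridiagonal operator on the half line, with \<open>N \<times> N\<close> blocks \<open>S\<close>, \<open>Q\<close>, \<open>P\<close> below, on and
  above the diagonal and the corner block \<open>Q'\<close> at \<open>k = 0\<close>.
\<close>

definition toeplitz_rhs ::
  "(nat \<Rightarrow> nat \<Rightarrow> rat) \<Rightarrow> (nat \<Rightarrow> nat \<Rightarrow> rat) \<Rightarrow> (nat \<Rightarrow> nat \<Rightarrow> rat) \<Rightarrow> (nat \<Rightarrow> nat \<Rightarrow> rat) \<Rightarrow> nat \<Rightarrow>
    (nat \<Rightarrow> nat \<Rightarrow> rat fls) \<Rightarrow> nat \<Rightarrow> nat \<Rightarrow> rat fls" where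
  "toeplitz_rhs P Q S Q' N u k i = (\<Sum>j<N.
     fls_const (P i j) * u (Suc k) j
     + fls_const ((if k = 0 then Q' else Q) i j) * u k j
     + (if k = 0 then 0 else fls_const (S i j) * u (k - 1) j))"

lemma order_ge_const_mult: "order_ge n x \<Longrightarrow> order_ge n (fls_const c * x)"
  using order_ge_mult[OF order_ge_const] by fastforce

lemma order_ge_toeplitz_rhs:
  "(\<And>k i. i < N \<Longrightarrow> order_ge n (u k i)) \<Longrightarrow> order_ge n (toeplitz_rhs P Q S Q' N u k i)"
  unfolding toeplitz_rhs_def
  by (intro order_ge_sum order_ge_add) (auto intro: order_ge_const_mult)

text \<open>
  Each use of the equation raises the valuation of all entries by one.
\<close>

lemma toeplitz_homogeneous_imp_0:
  assumes "\<And>k i. i < N \<Longrightarrow> order_ge c (u k i)"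
    and eq: "\<And>k i. i < N \<Longrightarrow> u k i = fls_X * toeplitz_rhs P Q S Q' N u k i"
    and "i < N"
  shows "u k i = 0"
proof (rule adic_contraction_imp_0[where N = N and c = c and u = u and k = k and i = i])
  fix n k i
  assume "\<And>k i. i < N \<Longrightarrow> order_ge n (u k i)" "i < N"
  then show "order_ge (n + 1) (u k i)"
    using order_ge_mult[OF order_ge_X order_ge_toeplitz_rhs[of N n u]]
    by (subst eq) (auto simp: add.commute)
qed (use assms in auto)

text \<open>
  The entries of \<open>z I - w (P + z Q + z\<^sup>2 S)\<close>, a matrix of polynomials in \<open>z\<close>; the equations for \<open>k \<ge> 1\<close> say
  how it acts on the generating functions.
\<close>

definition toeplitz_symbol ::
  "(nat \<Rightarrow> nat \<Rightarrow> rat) \<Rightarrow> (nat \<Rightarrow> nat \<Rightarrow> rat) \<Rightarrow> (nat \<Rightarrow> nat \<Rightarrow> rat) \<Rightarrow> nat \<Rightarrow> nat \<Rightarrow> rat fls poly" where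
  "toeplitz_symbol P Q S i j =
     [: - (fls_X * fls_const (P i j)),
        (if i = j then 1 else 0) - fls_X * fls_const (Q i j),
        - (fls_X * fls_const (S i j)) :]"

lemma fps_nth_quadratic_mult:
  fixes f :: "'a :: comm_ring_1 fps"
  shows "fps_nth (fps_of_poly [:a, b, c:] * f) (Suc (Suc k))
    = a * fps_nth f (Suc (Suc k)) + b * fps_nth f (Suc k) + c * fps_nth f k"
    and "fps_nth (fps_of_poly [:a, b, c:] * f) (Suc 0) = a * fps_nth f (Suc 0) + b * fps_nth f 0"
proof -
  have *: "fps_of_poly [:a, b, c:] * f
      = fps_const a * f + fps_X * (fps_const b * f) + fps_X * (fps_X * (fps_const c * f))"
    by (simp add: fps_of_poly_pCons algebra_simps)
  show "fps_nth (fps_of_poly [:a, b, c:] * f) (Suc (Suc k))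
      = a * fps_nth f (Suc (Suc k)) + b * fps_nth f (Suc k) + c * fps_nth f k"
    and "fps_nth (fps_of_poly [:a, b, c:] * f) (Suc 0) = a * fps_nth f (Suc 0) + b * fps_nth f 0"
    unfolding * by simp_all
qed

lemma sum_toeplitz_symbol_nth:
  assumes "i < N"
  shows "fps_nth (\<Sum>j<N. fps_of_poly (toeplitz_symbol P Q S i j) * Abs_fps (\<lambda>k. u k j)) (Suc k)
    = u k i - fls_X * toeplitz_rhs P Q S Q N u k i"
proof -
  \<comment> \<open>the coefficient \<open>z\<close> of the diagonal of the symbol shifts the index by one\<close>
  have delta: "(\<Sum>j<N. (if i = j then 1 else 0) * u k j) = u k i"
    using assms by (simp add: if_distrib[of "\<lambda>x. x * _"] cong: if_cong)
  show ?thesis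
  proof (cases k)
    case 0
    show ?thesis using delta
      unfolding 0 toeplitz_symbol_def toeplitz_rhs_def fps_sum_nth fps_nth_quadratic_mult
      by (simp add: sum.distrib sum_subtractf sum_negf sum_distrib_left algebra_simps)
  next
    case (Suc l)
    show ?thesis using delta
      unfolding Suc toeplitz_symbol_def toeplitz_rhs_def fps_sum_nth fps_nth_quadratic_mult
      by (simp add: sum.distrib sum_subtractf sum_negf sum_distrib_left algebra_simps)
  qed
qed

text \<open>
  A kernel vector of polynomials would be a solution of the homogeneous system with
  corner block \<open>Q\<close>, and its finitely many coefficients have bounded pole order.
\<close>

lemma det_toeplitz_symbol_nonzero:
  "det (mat N N (\<lambda>(i, j). toeplitz_symbol P Q S i j)) \<noteq> 0" (is "det ?A \<noteq> 0")
proof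
  have A: "?A \<in> carrier_mat N N" by simp
  assume "det ?A = 0"
  then obtain v where v: "v \<in> carrier_vec N" "v \<noteq> 0\<^sub>v N" "?A *\<^sub>v v = 0\<^sub>v N"
    using det_0_iff_vec_prod_zero[OF A] by blast
  define u where "u k i = coeff (v $ i) k" for k i
  have Abs: "Abs_fps (\<lambda>k. u k j) = fps_of_poly (v $ j)" for j
    by (rule fps_ext) (simp add: u_def)
  have Av: "(\<Sum>j<N. toeplitz_symbol P Q S i j * v $ j) = 0" if "i < N" for i
  proof -
    have "(?A *\<^sub>v v) $ i = (\<Sum>j<N. toeplitz_symbol P Q S i j * v $ j)"
      using that v(1) by (simp add: scalar_prod_def lessThan_atLeast0)
    then show ?thesis using v(3) that by simp
  qed
  obtain c where c: "\<And>i k. i < N \<Longrightarrow> order_ge c (fps_nth (fps_of_poly (v $ i)) k)"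
    using adically_bounded_uniform[of N "\<lambda>i. fps_of_poly (v $ i)"] adically_bounded_poly by blast
  have "u k i = 0" if "i < N" for k i
  proof (rule toeplitz_homogeneous_imp_0[OF _ _ that])
    fix k i assume i: "i < N"
    show "order_ge c (u k i)" using c[OF i, of k] by (simp add: u_def)
    have "u k i - fls_X * toeplitz_rhs P Q S Q N u k i
        = fps_nth (fps_of_poly (\<Sum>j<N. toeplitz_symbol P Q S i j * v $ j)) (Suc k)"
      unfolding sum_toeplitz_symbol_nth[OF i, symmetric] Abs
      by (simp add: fps_of_poly_sum fps_of_poly_mult)
    then show "u k i = fls_X * toeplitz_rhs P Q S Q N u k i" by (simp add: Av[OF i])
  qed
  then have "v = 0\<^sub>v N" using v(1) by (intro eq_vecI) (auto intro!: poly_eqI simp: u_def)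
  with v(2) show False by contradiction
qed

lemma fps_of_poly_if_eventually_0:
  assumes "\<And>n. n \<ge> m \<Longrightarrow> fps_nth f n = 0"
  shows "\<exists>p. f = fps_of_poly p"
proof -
  have "f = fps_of_poly (Poly (map (fps_nth f) [0..<m]))"
    by (rule fps_ext) (simp add: nth_default_def assms)
  then show ?thesis by blast
qed

text \<open>
  Cramer's rule. The symbol sends the vector of generating functions to the generating function of
  \<open>b\<close> up to low-order terms, and \<open>(1 - z)\<^sup>2\<close> turns the latter into a polynomial because \<open>b\<close> is affine in
  \<open>k\<close>.
\<close>

lemma toeplitz_generating_function_rational:
  assumes eq: "\<And>k i. i < N \<Longrightarrow> x k i = fls_X * toeplitz_rhs P Q S Q' N x k i + b k i"
    and b: "\<And>k i. i < N \<Longrightarrow> k \<ge> 1 \<Longrightarrow> b (k + 2) i - 2 * b (k + 1) i + b k i = 0"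
    and "i < N"
  shows "\<exists>R M. R \<noteq> 0 \<and> R \<in> rat_funs.polys \<and> fps_of_poly R * Abs_fps (\<lambda>k. x k i) = fps_of_poly M"
proof -
  define A where "A = mat N N (\<lambda>(i, j). toeplitz_symbol P Q S i j)"
  have A: "A \<in> carrier_mat N N" by (simp add: A_def)
  define G where "G j = Abs_fps (\<lambda>k. x k j)" for j
  define B where "B i = (\<Sum>j<N. fps_of_poly (toeplitz_symbol P Q S i j) * G j)" for i
  \<comment> \<open>\<open>(1 - z)\<^sup>2\<close>\<close>
  define E :: "rat fls poly" where "E = [:1, -2, 1:]"
  have "\<exists>p. fps_of_poly E * B i = fps_of_poly p" if "i < N" for i
  proof (rule fps_of_poly_if_eventually_0)
    have B: "fps_nth (B i) (Suc (Suc k)) = b (Suc k) i" for k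
      unfolding B_def G_def sum_toeplitz_symbol_nth[OF that]
      using eq[OF that, of "Suc k"] by (simp add: toeplitz_rhs_def)
    \<comment> \<open>\<open>B i\<close> has coefficient \<open>b (n - 1) i\<close> at \<open>n \<ge> 2\<close>, and \<open>b\<close> is affine from index 1 on,
      so the second difference vanishes from \<open>n = 4\<close> on.\<close>
    fix n :: nat assume "n \<ge> 4"
    then have n: "n = Suc (Suc (Suc (Suc (n - 4))))" by simp
    define k where "k = n - 4"
    note n = n[folded k_def]
    show "fps_nth (fps_of_poly E * B i) n = 0"
      using b[OF that, of "Suc k"] by (subst n) (simp add: E_def fps_nth_quadratic_mult B)
  qed
  then obtain p where p: "\<And>i. i < N \<Longrightarrow> fps_of_poly E * B i = fps_of_poly (p i)" by metis
  have adj: "(\<Sum>j<N. adj_mat A $$ (i, j) * toeplitz_symbol P Q S j l) = (if i = l then det A else 0)"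
    if "l < N" for l
  proof -
    have "(adj_mat A * A) $$ (i, l) = (\<Sum>j<N. adj_mat A $$ (i, j) * toeplitz_symbol P Q S j l)"
      using that assms(3) adj_mat(1)[OF A]
      by (simp add: A_def scalar_prod_def lessThan_atLeast0)
    then show ?thesis using that assms(3) by (cases "i = l") (simp_all add: adj_mat(3)[OF A])
  qed
  have "(\<Sum>j<N. fps_of_poly (adj_mat A $$ (i, j)) * B j)
      = (\<Sum>l<N. fps_of_poly (\<Sum>j<N. adj_mat A $$ (i, j) * toeplitz_symbol P Q S j l) * G l)"
    unfolding B_def sum_distrib_left fps_of_poly_sum sum_distrib_right
    by (subst sum.swap) (simp add: fps_of_poly_mult mult.assoc)
  also have "\<dots> = (\<Sum>l<N. if l = i then fps_of_poly (det A) * G i else 0)"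
    by (intro sum.cong) (auto simp: adj)
  also have "\<dots> = fps_of_poly (det A) * G i" using assms(3) by simp
  finally have det: "fps_of_poly (det A) * G i = (\<Sum>j<N. fps_of_poly (adj_mat A $$ (i, j)) * B j)" ..
  have "fps_of_poly (E * det A) * G i = fps_of_poly E * (\<Sum>j<N. fps_of_poly (adj_mat A $$ (i, j)) * B j)"
    by (simp add: fps_of_poly_mult mult.assoc det)
  also have "\<dots> = (\<Sum>j<N. fps_of_poly (adj_mat A $$ (i, j)) * (fps_of_poly E * B j))"
    by (simp add: sum_distrib_left mult_ac)
  also have "\<dots> = fps_of_poly (\<Sum>j<N. adj_mat A $$ (i, j) * p j)"
    by (simp add: p fps_of_poly_sum fps_of_poly_mult)
  finally have "fps_of_poly (E * det A) * G i = \<dots>" .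
  moreover have "E * det A \<noteq> 0"
    using det_toeplitz_symbol_nonzero[of N P Q S] unfolding A_def E_def mult_eq_0_iff by simp
  moreover have "E * det A \<in> rat_funs.polys"
  proof (intro rat_funs.polys_mult rat_funs.polys_det[OF A])
    have "(1 :: rat fls) \<in> rat_funs" "(- 2 :: rat fls) \<in> rat_funs"
      using rat_funs.one_mem rat_funs.uminus_mem[OF rat_funs.of_nat_mem[of 2]] by simp_all
    then show "E \<in> rat_funs.polys"
      unfolding E_def by (intro rat_funs.polys_pCons rat_funs.polys_0)
    fix i j assume "i < N" "j < N"
    then show "A $$ (i, j) \<in> rat_funs.polys"
      unfolding A_def toeplitz_symbol_def
      by (auto intro!: rat_funs.polys_pCons rat_funs.polys_0 rat_funs.uminus_mem rat_funs.mult_mem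
          rat_funs.diff_mem fls_X_rat_funs fls_const_rat_funs simp: rat_funs.one_mem rat_funs.zero_mem)
  qed
  ultimately show ?thesis unfolding G_def by blast
qed

text \<open>
  The solution and its image under an algebraic projection solve the same system and are both bounded,
  so they agree.
\<close>

lemma toeplitz_solution_algebraic:
  assumes eq: "\<And>k i. i < N \<Longrightarrow> x k i = fls_X * toeplitz_rhs P Q S Q' N x k i + b k i"
    and b: "\<And>k i. i < N \<Longrightarrow> k \<ge> 1 \<Longrightarrow> b (k + 2) i - 2 * b (k + 1) i + b k i = 0"
    and b_alg: "\<And>k i. i < N \<Longrightarrow> algebraic_over rat_funs (b k i)"
    and int: "\<And>k i. i < N \<Longrightarrow> order_ge 0 (x k i)"
    and i: "i < N"
  shows "algebraic_over rat_funs (x k i)"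
proof -
  obtain \<pi> :: "rat fls \<Rightarrow> rat fls"
    where pi: "\<And>x. algebraic_over rat_funs (\<pi> x)"
      "\<And>x y. \<pi> (x + y) = \<pi> x + \<pi> y"
      "\<And>c x. algebraic_over rat_funs c \<Longrightarrow> \<pi> (c * x) = c * \<pi> x"
      "\<And>c. algebraic_over rat_funs c \<Longrightarrow> \<pi> c = c"
    using exists_algebraic_projection by blast
  have pi0: "\<pi> 0 = 0" using pi(2)[of 0 0] by simp
  then have pi_sum: "\<pi> (sum h I) = (\<Sum>i\<in>I. \<pi> (h i))" for h and I :: "nat set"
    by (induction I rule: infinite_finite_induct) (simp_all add: pi(2))
  have pi_const: "\<pi> (fls_const c * y) = fls_const c * \<pi> y" for c y
    by (rule pi(3)) (simp add: rat_funs.algebraic_over_self fls_const_rat_funs)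
  have pi_X: "\<pi> (fls_X * y) = fls_X * \<pi> y" for y
    by (rule pi(3)) (simp add: rat_funs.algebraic_over_self fls_X_rat_funs)
  define y where "y k i = \<pi> (x k i)" for k i
  have pi_rhs: "\<pi> (toeplitz_rhs P Q S Q' N x k i) = toeplitz_rhs P Q S Q' N y k i" for k i
    by (simp add: toeplitz_rhs_def pi_sum pi(2) pi_const pi0 y_def)
  have y_eq: "y k i = fls_X * toeplitz_rhs P Q S Q' N y k i + b k i" if "i < N" for k i
    using arg_cong[OF eq[OF that, of k], of \<pi>]
    by (simp only: pi(2) pi_X pi_rhs pi(4)[OF b_alg[OF that]] flip: y_def)
  have "adically_bounded (Abs_fps (\<lambda>k. y k i))" if i: "i < N" for i
  proof -
    obtain R M where "R \<noteq> 0" "R \<in> rat_funs.polys" "fps_of_poly R * Abs_fps (\<lambda>k. x k i) = fps_of_poly M"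
      using toeplitz_generating_function_rational[OF eq b i] by blast
    moreover have "adically_bounded (Abs_fps (\<lambda>k. x k i))"
      unfolding adically_bounded_def using int[OF i] by auto
    ultimately have "adically_bounded (Abs_fps (\<lambda>k'. \<pi> (fps_nth (Abs_fps (\<lambda>k. x k i)) k')))"
      by (intro adically_bounded_projection[of \<pi>, OF pi(2,3)])
    then show ?thesis by (simp add: y_def)
  qed
  then obtain c where c: "\<And>i k. i < N \<Longrightarrow> order_ge c (y k i)"
    using adically_bounded_uniform[of N "\<lambda>i. Abs_fps (\<lambda>k. y k i)"] by auto
  define u where "u k i = x k i - y k i" for k i
  have "u k i = 0"
  proof (rule toeplitz_homogeneous_imp_0[OF _ _ i])
    fix k i assume i: "i < N"
    show "order_ge (min 0 c) (u k i)" unfolding u_def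
      by (intro order_ge_diff order_ge_mono[OF int[OF i]] order_ge_mono[OF c[OF i]]) simp_all
    have rhs: "toeplitz_rhs P Q S Q' N u k i = toeplitz_rhs P Q S Q' N x k i - toeplitz_rhs P Q S Q' N y k i"
      unfolding toeplitz_rhs_def u_def sum_subtractf[symmetric]
      by (intro sum.cong) (auto simp: algebra_simps)
    show "u k i = fls_X * toeplitz_rhs P Q S Q' N u k i"
      using eq[OF i, of k] y_eq[OF i, of k] unfolding rhs by (simp add: u_def right_diff_distrib)
  qed
  then have "x k i = y k i" by (simp add: u_def)
  then show ?thesis using pi(1)[of "x k i"] by (simp add: y_def)
qed

section \<open>The product at negative powers of two\<close>

definition oneX :: "rat \<Rightarrow> rat" where
  "oneX = on_dyadic (\<lambda>_. 1)"

lemma dyadic_unit_half: "t \<in> dyadic_unit \<Longrightarrow> t / 2 \<in> dyadic_unit"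
  and dyadic_unit_half_right: "t \<in> dyadic_unit \<Longrightarrow> (1 + t) / 2 \<in> dyadic_unit"
proof -
  assume "t \<in> dyadic_unit"
  then obtain k where t: "0 \<le> t" "t \<le> 1" and k: "t * 2 ^ k \<in> \<int>" by (auto simp: dyadic_unit_def)
  have "t / 2 * 2 ^ Suc k \<in> \<int>" using k by simp
  then show "t / 2 \<in> dyadic_unit" using t unfolding dyadic_unit_def by (auto simp del: power_Suc)
  have "(1 + t) / 2 * 2 ^ Suc k = 2 ^ k + t * 2 ^ k" by (simp add: algebra_simps)
  also have "\<dots> \<in> \<int>" using k by simp
  finally show "(1 + t) / 2 \<in> dyadic_unit"
    using t unfolding dyadic_unit_def by (auto simp del: power_Suc)
qed

lemma T0_add: "T0 (\<alpha> + \<beta>) = T0 \<alpha> + T0 \<beta>" and T1_add: "T1 (\<alpha> + \<beta>) = T1 \<alpha> + T1 \<beta>"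
  and T0_scale: "T0 (fun_scale c \<alpha>) = fun_scale c (T0 \<alpha>)"
  and T1_scale: "T1 (fun_scale c \<alpha>) = fun_scale c (T1 \<alpha>)"
  by (auto simp: T0_def T1_def fun_scale_def on_dyadic_def fun_eq_iff)

lemma inverse_power2_in_dyadic_unit: "1 / 2 ^ n \<in> dyadic_unit"
  by (auto simp: dyadic_unit_def intro!: exI[of _ n] Ints_1)

lemma hash_power2_0: "hash \<alpha> \<beta> (1 / 2 ^ 0) = (\<alpha> 1 - \<alpha> 0) * (\<beta> 1 - \<beta> 0)"
  by (simp add: hash_1)

lemma hash_power2_Suc:
  "hash \<alpha> \<beta> (1 / 2 ^ Suc n) = hash (T0 \<alpha>) (T0 \<beta>) (1 / 2 ^ n) + hash (T1 \<alpha>) (T1 \<beta>) (1 / 2 ^ n)"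
proof -
  have "1 / 2 ^ Suc n \<le> (1/2 :: rat)" by (simp add: field_simps)
  from hash_left[OF inverse_power2_in_dyadic_unit this, of \<alpha> \<beta>] show ?thesis by simp
qed

lemma hash_power2_add_left:
  "hash (\<alpha> + \<alpha>') \<beta> (1 / 2 ^ n) = hash \<alpha> \<beta> (1 / 2 ^ n) + hash \<alpha>' \<beta> (1 / 2 ^ n)"
proof (induction n arbitrary: \<alpha> \<alpha>' \<beta>)
  case 0
  show ?case unfolding hash_power2_0 by (simp add: algebra_simps)
next
  case (Suc n)
  show ?case unfolding hash_power2_Suc T0_add T1_add Suc by simp
qed

lemma hash_power2_scale_left:
  "hash (fun_scale c \<alpha>) \<beta> (1 / 2 ^ n) = c * hash \<alpha> \<beta> (1 / 2 ^ n)"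
proof (induction n arbitrary: \<alpha> \<beta>)
  case 0
  show ?case unfolding hash_power2_0 by (simp add: fun_scale_def algebra_simps)
next
  case (Suc n)
  show ?case unfolding hash_power2_Suc T0_scale T1_scale Suc by (simp add: algebra_simps)
qed

lemma hash_power2_add_right:
  "hash \<alpha> (\<beta> + \<beta>') (1 / 2 ^ n) = hash \<alpha> \<beta> (1 / 2 ^ n) + hash \<alpha> \<beta>' (1 / 2 ^ n)"
proof (induction n arbitrary: \<alpha> \<beta> \<beta>')
  case 0
  show ?case unfolding hash_power2_0 by (simp add: algebra_simps)
next
  case (Suc n)
  show ?case unfolding hash_power2_Suc T0_add T1_add Suc by simp
qed

lemma hash_power2_scale_right:
  "hash \<alpha> (fun_scale c \<beta>) (1 / 2 ^ n) = c * hash \<alpha> \<beta> (1 / 2 ^ n)"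
proof (induction n arbitrary: \<alpha> \<beta>)
  case 0
  show ?case unfolding hash_power2_0 by (simp add: fun_scale_def algebra_simps)
next
  case (Suc n)
  show ?case unfolding hash_power2_Suc T0_scale T1_scale Suc by (simp add: algebra_simps)
qed

definition hash_series :: "(rat \<Rightarrow> rat) \<Rightarrow> (rat \<Rightarrow> rat) \<Rightarrow> rat fls" where
  "hash_series \<alpha> \<beta> = fps_to_fls (S_series (hash \<alpha> \<beta>))"

lemma hash_series_add_left: "hash_series (\<alpha> + \<alpha>') \<beta> = hash_series \<alpha> \<beta> + hash_series \<alpha>' \<beta>"
  and hash_series_add_right: "hash_series \<alpha> (\<beta> + \<beta>') = hash_series \<alpha> \<beta> + hash_series \<alpha> \<beta>'"
  unfolding hash_series_def S_series_def fps_to_fls_plus[symmetric]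
    fps_to_fls_eq_iff fps_eq_iff fps_add_nth
  by (simp_all add: hash_power2_add_left hash_power2_add_right distrib_right)

lemma hash_series_scale_left: "hash_series (fun_scale c \<alpha>) \<beta> = fls_const c * hash_series \<alpha> \<beta>"
  and hash_series_scale_right: "hash_series \<alpha> (fun_scale c \<beta>) = fls_const c * hash_series \<alpha> \<beta>"
  unfolding hash_series_def S_series_def
  by (intro fls_eqI; simp add: hash_power2_scale_left hash_power2_scale_right)+

lemma hash_series_sum_left:
  "hash_series (\<Sum>i\<in>I. fun_scale (c i) (f i)) \<beta> = (\<Sum>i\<in>I. fls_const (c i) * hash_series (f i) \<beta>)"
proof -
  have zero: "hash_series 0 \<beta> = 0"
    using hash_series_add_left[of 0 0 \<beta>] by (simp only: add_0_left) simp
  show ?thesis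
    by (induction I rule: infinite_finite_induct)
      (simp_all only: sum.infinite sum.empty sum.insert zero hash_series_add_left hash_series_scale_left simp_thms)
qed

lemma hash_series_rec:
  "hash_series \<alpha> \<beta> = fls_const ((\<alpha> 1 - \<alpha> 0) * (\<beta> 1 - \<beta> 0))
     + fls_const 2 * fls_X * (hash_series (T0 \<alpha>) (T0 \<beta>) + hash_series (T1 \<alpha>) (T1 \<beta>))"
proof -
  have "S_series (hash \<alpha> \<beta>) = fps_const ((\<alpha> 1 - \<alpha> 0) * (\<beta> 1 - \<beta> 0))
     + fps_const 2 * fps_X * (S_series (hash (T0 \<alpha>) (T0 \<beta>)) + S_series (hash (T1 \<alpha>) (T1 \<beta>)))"
  proof (rule fps_ext)
    fix n
    show "fps_nth (S_series (hash \<alpha> \<beta>)) n = fps_nth (fps_const ((\<alpha> 1 - \<alpha> 0) * (\<beta> 1 - \<beta> 0))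
     + fps_const 2 * fps_X * (S_series (hash (T0 \<alpha>) (T0 \<beta>)) + S_series (hash (T1 \<alpha>) (T1 \<beta>)))) n"
    proof (cases n)
      case 0
      then show ?thesis using hash_power2_0[of \<alpha> \<beta>] by (simp add: S_series_def mult.assoc)
    next
      case (Suc m)
      then show ?thesis
        using hash_power2_Suc[of \<alpha> \<beta> m] by (simp add: S_series_def mult.assoc distrib_right algebra_simps)
    qed
  qed
  then show ?thesis
    unfolding hash_series_def by (simp add: fls_times_fps_to_fls)
qed

lemma T_oneX: "T0 oneX = oneX" "T1 oneX = oneX"
  by (auto simp: T0_def T1_def oneX_def on_dyadic_def fun_eq_iff dyadic_unit_half dyadic_unit_half_right)

lemma T_tX: "T0 tX = fun_scale (1/2) tX" "T1 tX = fun_scale (1/2) (oneX + tX)"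
  by (auto simp: T0_def T1_def tX_def oneX_def fun_scale_def on_dyadic_def fun_eq_iff
      dyadic_unit_half dyadic_unit_half_right)

lemma T_eps: "T0 eps = fun_scale (1/4) (eps + tX)"
  "T1 eps = fun_scale (1/4) (eps + (oneX + fun_scale (-1) tX))"
  by (auto simp: T0_def T1_def tX_def oneX_def eps_def fun_scale_def on_dyadic_def fun_eq_iff
      dyadic_unit_half dyadic_unit_half_right power2_eq_square add_divide_distrib[symmetric])
     (auto simp: field_simps)

lemma phi_outside: "t \<notin> dyadic_unit \<Longrightarrow> phi m t = 0"
  using phi_in_X[of m] by (auto simp: X_def)

lemma T0_phi:
  "even m \<Longrightarrow> T0 (phi m) = fun_scale (1/8) (phi (m + 1) + fun_scale (4 * of_nat m + 3) tX)"
  "odd m \<Longrightarrow> T0 (phi m) = fun_scale (1/8) (phi (m - 1) + eps + fun_scale (4 * of_nat m + 3) tX)"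
proof -
  have *: "t / 2 \<le> 1 / 2" if "t \<in> dyadic_unit" for t :: rat
    using that by (simp add: dyadic_unit_def)
  show "T0 (phi m) = fun_scale (1/8) (phi (m + 1) + fun_scale (4 * of_nat m + 3) tX)" if "even m"
  proof
    fix t
    show "T0 (phi m) t = fun_scale (1/8) (phi (m + 1) + fun_scale (4 * of_nat m + 3) tX) t"
      using phi_left(1)[OF dyadic_unit_half * that, of t]
      by (cases "t \<in> dyadic_unit")
        (auto simp: T0_def on_dyadic_def fun_scale_def tX_def phi_outside field_simps)
  qed
  show "T0 (phi m) = fun_scale (1/8) (phi (m - 1) + eps + fun_scale (4 * of_nat m + 3) tX)" if "odd m"
  proof
    fix t
    show "T0 (phi m) t = fun_scale (1/8) (phi (m - 1) + eps + fun_scale (4 * of_nat m + 3) tX) t"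
      using phi_left(2)[OF dyadic_unit_half * that, of t]
      by (cases "t \<in> dyadic_unit")
        (auto simp: T0_def on_dyadic_def fun_scale_def tX_def eps_def phi_outside field_simps)
  qed
qed

lemma T1_phi:
  "T1 (phi 0) = fun_scale (1/8) (phi 0 + fun_scale 3 (oneX + fun_scale (-1) tX))"
  "even m \<Longrightarrow> m \<noteq> 0 \<Longrightarrow>
    T1 (phi m) = fun_scale (1/8) (phi (m - 1) + eps + fun_scale (4 * of_nat m + 3) (oneX + fun_scale (-1) tX))"
  "odd m \<Longrightarrow>
    T1 (phi m) = fun_scale (1/8) (phi (m + 1) + fun_scale (4 * of_nat m + 3) (oneX + fun_scale (-1) tX))"
proof -
  have *: "1 / 2 \<le> (1 + t) / 2" if "t \<in> dyadic_unit" for t :: rat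
    using that by (simp add: dyadic_unit_def)
  have **: "2 * ((1 + t) / 2) - 1 = t" "1 - (1 + t) / 2 = (1 - t) / 2" for t :: rat
    by (simp_all add: field_simps)
  note right = phi_right[OF dyadic_unit_half_right *, unfolded **]
  show "T1 (phi 0) = fun_scale (1/8) (phi 0 + fun_scale 3 (oneX + fun_scale (-1) tX))"
  proof
    fix t
    show "T1 (phi 0) t = fun_scale (1/8) (phi 0 + fun_scale 3 (oneX + fun_scale (-1) tX)) t"
      using right(1)[of t]
      by (cases "t \<in> dyadic_unit")
        (auto simp: T1_def on_dyadic_def fun_scale_def tX_def oneX_def phi_outside field_simps)
  qed
  show "T1 (phi m) = fun_scale (1/8) (phi (m - 1) + eps + fun_scale (4 * of_nat m + 3) (oneX + fun_scale (-1) tX))"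
    if "even m" "m \<noteq> 0"
  proof
    fix t
    show "T1 (phi m) t =
      fun_scale (1/8) (phi (m - 1) + eps + fun_scale (4 * of_nat m + 3) (oneX + fun_scale (-1) tX)) t"
      using right(2)[of t m] that
      by (cases "t \<in> dyadic_unit")
        (auto simp: T1_def on_dyadic_def fun_scale_def tX_def oneX_def eps_def phi_outside field_simps)
  qed
  show "T1 (phi m) = fun_scale (1/8) (phi (m + 1) + fun_scale (4 * of_nat m + 3) (oneX + fun_scale (-1) tX))"
    if "odd m"
  proof
    fix t
    show "T1 (phi m) t =
      fun_scale (1/8) (phi (m + 1) + fun_scale (4 * of_nat m + 3) (oneX + fun_scale (-1) tX)) t"
      using right(3)[of t m] that
      by (cases "t \<in> dyadic_unit")
        (auto simp: T1_def on_dyadic_def fun_scale_def tX_def oneX_def eps_def phi_outside field_simps)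
  qed
qed

section \<open>The equations for the series of products\<close>

text \<open>
  The geometric series \<open>1 + w + w\<^sup>2 + \<dots>\<close>.
\<close>

definition geo :: "rat fls" where "geo = inverse (1 - fls_X)"

lemma geo_rat_funs: "geo \<in> rat_funs"
  unfolding geo_def
  by (intro rat_funs.inverse_mem rat_funs.diff_mem rat_funs.one_mem fls_X_rat_funs)

lemma one_minus_fls_X_nonzero: "(1 - fls_X :: rat fls) \<noteq> 0"
proof
  assume "(1 - fls_X :: rat fls) = 0"
  then have "fls_nth (1 - fls_X :: rat fls) 0 = 0" by simp
  then show False by simp
qed

lemma hash_power2_oneX: "hash \<alpha> oneX (1 / 2 ^ n) = 0"
proof (induction n arbitrary: \<alpha>)
  case 0
  show ?case unfolding hash_power2_0 by (simp add: oneX_def on_dyadic_def)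
next
  case (Suc n)
  show ?case unfolding hash_power2_Suc T_oneX Suc by simp
qed

lemma hash_series_oneX: "hash_series \<alpha> oneX = 0"
  by (simp add: hash_series_def S_series_def hash_power2_oneX fls_eq_iff)

lemma increment_halves: "(T0 \<alpha> 1 - T0 \<alpha> 0) + (T1 \<alpha> 1 - T1 \<alpha> 0) = \<alpha> 1 - \<alpha> 0"
  by (simp add: T0_def T1_def on_dyadic_def)

text \<open>
  Only the increment of \<open>\<alpha>\<close> over the whole interval survives, because the increments of the two halves add up
  to it and are both multiplied by the same slope.
\<close>

lemma hash_power2_tX: "hash \<alpha> tX (1 / 2 ^ n) = (\<alpha> 1 - \<alpha> 0) / 2 ^ n"
proof (induction n arbitrary: \<alpha>)
  case 0
  show ?case unfolding hash_power2_0 by (simp add: tX_def on_dyadic_def)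
next
  case (Suc n)
  show ?case
    unfolding hash_power2_Suc T_tX hash_power2_scale_right hash_power2_add_right hash_power2_oneX Suc
      increment_halves[of \<alpha>, symmetric]
    by (simp add: field_simps)
qed

lemma hash_series_tX: "hash_series \<alpha> tX = fls_const (\<alpha> 1 - \<alpha> 0) * geo"
proof -
  have "(1 - fps_X) * S_series (hash \<alpha> tX) = fps_const (\<alpha> 1 - \<alpha> 0)"
    by (rule fps_ext) (simp add: S_series_def hash_power2_tX left_diff_distrib fps_X_mult_nth)
  then have "fps_to_fls ((1 - fps_X) * S_series (hash \<alpha> tX)) = fls_const (\<alpha> 1 - \<alpha> 0)" by simp
  then have "(1 - fls_X) * hash_series \<alpha> tX = fls_const (\<alpha> 1 - \<alpha> 0)"
    unfolding hash_series_def by (simp add: fls_times_fps_to_fls)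
  then show ?thesis
    using one_minus_fls_X_nonzero by (simp add: geo_def field_simps)
qed

text \<open>
  The difference of the increments over the left and the right half, that is
  \<open>2 \<alpha>(1/2) - \<alpha>(0) - \<alpha>(1)\<close>.
\<close>

definition second_diff :: "(rat \<Rightarrow> rat) \<Rightarrow> rat" where
  "second_diff \<alpha> = (T0 \<alpha> 1 - T0 \<alpha> 0) - (T1 \<alpha> 1 - T1 \<alpha> 0)"

lemma fls_const_arith:
  "fls_const (a + b) = fls_const a + fls_const b" "fls_const (a - b) = fls_const a - fls_const (b :: rat)"
  "fls_const (a * b) = fls_const a * fls_const b"
  by (simp_all add: fls_plus_const fls_minus_const flip: fls_const_mult_const)

lemma fls_const_numerals:
  "fls_const 2 * fls_const (1/8) = fls_const (1/4 :: rat)"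
  "fls_const 2 * fls_const (1/4) = fls_const (1/2 :: rat)"
  by (simp_all only: fls_const_arith(3)[symmetric], simp_all)

lemmas hash_series_linear_right =
  hash_series_scale_right hash_series_add_right hash_series_oneX hash_series_tX

lemma fls_const_minus_1: "fls_const (- 1 :: rat) = - 1"
  by (rule fls_eqI) (simp add: fls_const_nth)

lemma fls_const_second_diff: "fls_const (second_diff \<alpha>) =
    fls_const (T0 \<alpha> 1 - T0 \<alpha> 0) - fls_const (T1 \<alpha> 1 - T1 \<alpha> 0)"
  by (simp only: second_diff_def fls_const_arith(2))

lemma hash_series_eps:
  "hash_series \<alpha> eps = fls_X * (fls_const (1/2) *
     (hash_series (T0 \<alpha>) eps + hash_series (T1 \<alpha>) eps + fls_const (second_diff \<alpha>) * geo))"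
proof -
  have "(\<alpha> 1 - \<alpha> 0) * (eps 1 - eps 0) = 0" by (simp add: eps_def on_dyadic_def)
  then have "hash_series \<alpha> eps = fls_const 2 * fls_X * (hash_series (T0 \<alpha>) (T0 eps) + hash_series (T1 \<alpha>) (T1 eps))"
    by (subst hash_series_rec) simp
  also have "hash_series (T0 \<alpha>) (T0 eps) + hash_series (T1 \<alpha>) (T1 eps) = fls_const (1/4) *
     (hash_series (T0 \<alpha>) eps + hash_series (T1 \<alpha>) eps + fls_const (second_diff \<alpha>) * geo)"
    unfolding T_eps hash_series_linear_right fls_const_second_diff fls_const_minus_1
    by (simp only: distrib_left distrib_right left_diff_distrib) (simp add: algebra_simps)
  finally have "hash_series \<alpha> eps = fls_const 2 * fls_X * (fls_const (1/4) *
     (hash_series (T0 \<alpha>) eps + hash_series (T1 \<alpha>) eps + fls_const (second_diff \<alpha>) * geo))" .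
  then show ?thesis unfolding fls_const_numerals(2)[symmetric] by (simp only: mult_ac)
qed

text \<open>
  The linear terms of \<open>T0 (phi m)\<close> and \<open>T1 (phi m)\<close> have opposite slopes, so they contribute through
  \<^const>\<open>second_diff\<close> only. Multiplying by the factor \<open>2 w\<close> of the recursion turns \<open>1/8\<close> into \<open>w/4\<close>.
\<close>

lemma hash_series_phi:
  "hash_series \<alpha> (phi 0) = fls_X * (fls_const (1/4) *
     (hash_series (T0 \<alpha>) (phi 1) + hash_series (T1 \<alpha>) (phi 0) + fls_const (3 * second_diff \<alpha>) * geo))"
  "even m \<Longrightarrow> m \<noteq> 0 \<Longrightarrow> hash_series \<alpha> (phi m) = fls_X * (fls_const (1/4) *
     (hash_series (T0 \<alpha>) (phi (m + 1)) + hash_series (T1 \<alpha>) (phi (m - 1)) + hash_series (T1 \<alpha>) eps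
       + fls_const ((4 * of_nat m + 3) * second_diff \<alpha>) * geo))"
  "odd m \<Longrightarrow> hash_series \<alpha> (phi m) = fls_X * (fls_const (1/4) *
     (hash_series (T0 \<alpha>) (phi (m - 1)) + hash_series (T1 \<alpha>) (phi (m + 1)) + hash_series (T0 \<alpha>) eps
       + fls_const ((4 * of_nat m + 3) * second_diff \<alpha>) * geo))"
proof -
  have rec: "hash_series \<alpha> (phi m) = fls_const 2 * fls_X *
      (hash_series (T0 \<alpha>) (T0 (phi m)) + hash_series (T1 \<alpha>) (T1 (phi m)))" for m
    by (subst hash_series_rec) simp
  note lin = hash_series_linear_right fls_const_second_diff fls_const_minus_1 fls_const_arith(3)
    distrib_left distrib_right left_diff_distrib right_diff_distrib
  have "hash_series (T0 \<alpha>) (T0 (phi 0)) + hash_series (T1 \<alpha>) (T1 (phi 0)) = fls_const (1/8) *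
     (hash_series (T0 \<alpha>) (phi 1) + hash_series (T1 \<alpha>) (phi 0) + fls_const (3 * second_diff \<alpha>) * geo)"
    unfolding T0_phi(1)[of 0, simplified] T1_phi(1) One_nat_def lin
    by (simp add: algebra_simps)
  from rec[of 0, unfolded this] show "hash_series \<alpha> (phi 0) = fls_X * (fls_const (1/4) *
     (hash_series (T0 \<alpha>) (phi 1) + hash_series (T1 \<alpha>) (phi 0) + fls_const (3 * second_diff \<alpha>) * geo))"
    unfolding fls_const_numerals(1)[symmetric] by (simp only: mult_ac)
  show "hash_series \<alpha> (phi m) = fls_X * (fls_const (1/4) *
     (hash_series (T0 \<alpha>) (phi (m + 1)) + hash_series (T1 \<alpha>) (phi (m - 1)) + hash_series (T1 \<alpha>) eps
       + fls_const ((4 * of_nat m + 3) * second_diff \<alpha>) * geo))" if "even m" "m \<noteq> 0"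
  proof -
    define c :: rat where "c = 4 * of_nat m + 3"
    have "hash_series (T0 \<alpha>) (T0 (phi m)) + hash_series (T1 \<alpha>) (T1 (phi m)) = fls_const (1/8) *
     (hash_series (T0 \<alpha>) (phi (m + 1)) + hash_series (T1 \<alpha>) (phi (m - 1)) + hash_series (T1 \<alpha>) eps
       + fls_const (c * second_diff \<alpha>) * geo)"
      unfolding T0_phi(1)[OF that(1)] T1_phi(2)[OF that] c_def[symmetric] lin
      by (simp add: algebra_simps)
    from rec[of m, unfolded this] show ?thesis
      unfolding fls_const_numerals(1)[symmetric] c_def by (simp only: mult_ac)
  qed
  show "hash_series \<alpha> (phi m) = fls_X * (fls_const (1/4) *
     (hash_series (T0 \<alpha>) (phi (m - 1)) + hash_series (T1 \<alpha>) (phi (m + 1)) + hash_series (T0 \<alpha>) eps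
       + fls_const ((4 * of_nat m + 3) * second_diff \<alpha>) * geo))" if "odd m"
  proof -
    define c :: rat where "c = 4 * of_nat m + 3"
    have "hash_series (T0 \<alpha>) (T0 (phi m)) + hash_series (T1 \<alpha>) (T1 (phi m)) = fls_const (1/8) *
     (hash_series (T0 \<alpha>) (phi (m - 1)) + hash_series (T1 \<alpha>) (phi (m + 1)) + hash_series (T0 \<alpha>) eps
       + fls_const (c * second_diff \<alpha>) * geo)"
      unfolding T0_phi(2)[OF that] T1_phi(3)[OF that] c_def[symmetric] lin
      by (simp add: algebra_simps)
    from rec[of m, unfolded this] show ?thesis
      unfolding fls_const_numerals(1)[symmetric] c_def by (simp only: mult_ac)
  qed
qed

lemma sum_double: "(\<Sum>j<2 * d. f j) = (\<Sum>j<d. f (2 * j) + f (2 * j + 1))"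
  for f :: "nat \<Rightarrow> 'a :: comm_monoid_add"
  by (induction d) (simp_all add: add.assoc)

lemma order_ge_hash_series: "order_ge 0 (hash_series \<alpha> \<beta>)"
  unfolding hash_series_def by (rule order_ge_fps_to_fls)

text \<open>
  Here the recursion stays within the finitely many series \<open>hash_series (b i) eps\<close>. It is a
  half-line system concentrated in the corner \<open>k = 0\<close>.
\<close>

lemma algebraic_hash_series_eps:
  fixes d :: nat
  assumes A: "\<And>i. i < d \<Longrightarrow> T0 (b i) = (\<Sum>j<d. fun_scale (A i j) (b j))"
    and B: "\<And>i. i < d \<Longrightarrow> T1 (b i) = (\<Sum>j<d. fun_scale (B i j) (b j))"
    and i: "i < d"
  shows "algebraic_over rat_funs (hash_series (b i) eps)"
proof -
  define x where "x k i = (if k = 0 then hash_series (b i) eps else 0)" for k :: nat and i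
  define c where "c k i = (if k = 0 then fls_X * (fls_const (1/2) * (fls_const (second_diff (b i)) * geo)) else 0)"
    for k :: nat and i
  define Q where "Q i j = (A i j + B i j) / 2" for i j
  have "algebraic_over rat_funs (x 0 i)"
  proof (rule toeplitz_solution_algebraic[where N = d and b = c
        and P = "\<lambda>_ _. 0" and Q = "\<lambda>_ _. 0" and S = "\<lambda>_ _. 0" and Q' = Q])
    fix k i assume i: "i < d"
    have "fls_const (1/2) * fls_const (A i j + B i j) = fls_const (Q i j)" for j
      by (simp add: Q_def flip: fls_const_arith(3))
    then have Q: "fls_const (1/2) * (fls_const (A i j + B i j) * y) = fls_const (Q i j) * y" for j y
      by (simp flip: mult.assoc)
    have "x 0 i = fls_X * (\<Sum>j<d. fls_const (Q i j) * x 0 j) + c 0 i"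
      unfolding x_def c_def if_P[OF refl]
      by (subst hash_series_eps)
        (simp add: A[OF i] B[OF i] hash_series_sum_left distrib_left sum_distrib_left Q[symmetric]
          fls_const_arith(1) distrib_right sum.distrib)
    then show "x k i = fls_X * toeplitz_rhs (\<lambda>_ _. 0) (\<lambda>_ _. 0) (\<lambda>_ _. 0) Q d x k i + c k i"
      by (cases "k = 0") (simp_all add: toeplitz_rhs_def, simp_all add: x_def c_def)
    show "algebraic_over rat_funs (c k i)"
      unfolding c_def
      by (auto intro!: rat_funs.algebraic_over_self rat_funs.zero_mem rat_funs.mult_mem
          fls_X_rat_funs fls_const_rat_funs geo_rat_funs)
    show "order_ge 0 (x k i)" by (simp add: x_def order_ge_hash_series)
    show "c (k + 2) i - 2 * c (k + 1) i + c k i = 0" if "k \<ge> 1"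
      using that by (simp add: c_def)
  qed (use i in simp_all)
  then show ?thesis by (simp add: x_def)
qed

text \<open>
  Index \<open>I = 2 i + p\<close> of block \<open>k\<close> stands for the basis function \<open>b i\<close> and \<open>m = 2 k + p\<close>. Going up from even \<open>m\<close>
  or down from odd \<open>m\<close> uses the matrix \<open>A\<close> of \<open>T0\<close> and stays in the block; the other steps use the matrix
  \<open>B\<close> of \<open>T1\<close> and change it. The corner block differs from \<open>Q\<close> since the right half of
  \<open>phi 0\<close> refers to \<open>phi 0\<close> again.
\<close>

lemma algebraic_hash_series_phi:
  fixes d :: nat
  assumes A: "\<And>i. i < d \<Longrightarrow> T0 (b i) = (\<Sum>j<d. fun_scale (A i j) (b j))"
    and B: "\<And>i. i < d \<Longrightarrow> T1 (b i) = (\<Sum>j<d. fun_scale (B i j) (b j))"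
    and i: "i < d"
  shows "algebraic_over rat_funs (hash_series (b i) (phi 0))"
proof -
  note eps_alg = algebraic_hash_series_eps[where b = b and d = d, OF A B]
  define x where "x k I = hash_series (b (I div 2)) (phi (2 * k + I mod 2))" for k I :: nat
  define P where "P I J = (if odd I \<and> even J then B (I div 2) (J div 2) / 4 else 0)" for I J
  define Q where "Q I J = (if even I = odd J then A (I div 2) (J div 2) / 4 else 0)" for I J
  define S where "S I J = (if even I \<and> odd J then B (I div 2) (J div 2) / 4 else 0)" for I J
  define Q' where "Q' I J = (if even I \<and> even J then B (I div 2) (J div 2) / 4 else Q I J)" for I J
  define c where "c k I = fls_X * (fls_const (1/4) *
      ((if even I then if k = 0 then 0 else \<Sum>j<d. fls_const (B (I div 2) j) * hash_series (b j) eps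
        else \<Sum>j<d. fls_const (A (I div 2) j) * hash_series (b j) eps)
       + fls_const ((4 * of_nat (2 * k + I mod 2) + 3) * second_diff (b (I div 2))) * geo))" for k I :: nat
  have quarter: "fls_const (1/4) * (fls_const a * y) = fls_const (a / 4) * y" for a :: rat and y
    by (simp flip: mult.assoc fls_const_arith(3))
  have "algebraic_over rat_funs (x 0 (2 * i))"
  proof (rule toeplitz_solution_algebraic[where N = "2 * d" and b = c
        and P = P and Q = Q and S = S and Q' = Q'])
    fix k I :: nat assume I: "I < 2 * d"
    then have i: "I div 2 < d" by auto
    define i where "i = I div 2"
    note i = i[folded i_def]
    show "x k I = fls_X * toeplitz_rhs P Q S Q' (2 * d) x k I + c k I"
    proof (cases "even I")
      case True
      then have I: "I = 2 * i" by (auto simp: i_def)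
      show ?thesis
      proof (cases k)
        case 0
        have "hash_series (b i) (phi 0) = fls_X * (\<Sum>j<d. fls_const (A i j / 4) * hash_series (b j) (phi 1)
            + fls_const (B i j / 4) * hash_series (b j) (phi 0))
            + fls_X * (fls_const (1/4) * (fls_const (3 * second_diff (b i)) * geo))"
          by (subst hash_series_phi(1))
            (simp add: A[OF i] B[OF i] hash_series_sum_left distrib_left sum_distrib_left quarter sum.distrib)
        then show ?thesis
          by (simp add: I 0 x_def c_def toeplitz_rhs_def sum_double P_def Q_def S_def Q'_def add.commute)
      next
        case (Suc l)
        have ev: "even (2 * Suc l)" "2 * Suc l \<noteq> 0" by simp_all
        have "hash_series (b i) (phi (2 * Suc l)) = fls_X * (\<Sum>j<d. fls_const (A i j / 4) * hash_series (b j) (phi (2 * Suc l + 1))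
            + fls_const (B i j / 4) * hash_series (b j) (phi (2 * Suc l - 1)))
            + fls_X * (fls_const (1/4) * ((\<Sum>j<d. fls_const (B i j) * hash_series (b j) eps)
              + fls_const ((4 * of_nat (2 * Suc l) + 3) * second_diff (b i)) * geo))"
          by (subst hash_series_phi(2)[OF ev])
            (simp add: A[OF i] B[OF i] hash_series_sum_left distrib_left sum_distrib_left quarter sum.distrib)
        then show ?thesis
          by (simp add: I Suc x_def c_def toeplitz_rhs_def sum_double P_def Q_def S_def Q'_def)
      qed
    next
      case False
      then have I: "I = 2 * i + 1" by (auto simp: i_def)
      have od: "odd (2 * k + 1)" by simp
      have "hash_series (b i) (phi (2 * k + 1)) = fls_X * (\<Sum>j<d. fls_const (A i j / 4) * hash_series (b j) (phi (2 * k))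
          + fls_const (B i j / 4) * hash_series (b j) (phi (2 * Suc k)))
          + fls_X * (fls_const (1/4) * ((\<Sum>j<d. fls_const (A i j) * hash_series (b j) eps)
            + fls_const ((4 * of_nat (2 * k + 1) + 3) * second_diff (b i)) * geo))"
        by (subst hash_series_phi(3)[OF od])
          (simp add: A[OF i] B[OF i] hash_series_sum_left distrib_left sum_distrib_left quarter sum.distrib)
      then show ?thesis
        by (simp add: I x_def c_def toeplitz_rhs_def sum_double P_def Q_def S_def Q'_def add.commute)
    qed
    have alg: "algebraic_over rat_funs (fls_const q)" "algebraic_over rat_funs fls_X"
      "algebraic_over rat_funs geo" "algebraic_over rat_funs 0" for q
      by (simp_all add: rat_funs.algebraic_over_self fls_const_rat_funs fls_X_rat_funs geo_rat_funs
          rat_funs.zero_mem)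
    have sum_alg: "algebraic_over rat_funs (\<Sum>j<d. fls_const (C j) * hash_series (b j) eps)" for C
      using alg_laurent.sum_mem[of "{..<d}" "\<lambda>j. fls_const (C j) * hash_series (b j) eps"]
        alg_laurent.mult_mem alg(1) eps_alg by simp
    show "algebraic_over rat_funs (c k I)"
      unfolding c_def
      using alg sum_alg alg_laurent.mult_mem alg_laurent.add_mem by simp
    show "order_ge 0 (x k I)" by (simp add: x_def order_ge_hash_series)
    show "c (k + 2) I - 2 * c (k + 1) I + c k I = 0" if "k \<ge> 1"
    proof -
      define s where "s = (if even I then \<Sum>j<d. fls_const (B (I div 2) j) * hash_series (b j) eps
        else \<Sum>j<d. fls_const (A (I div 2) j) * hash_series (b j) eps)"
      define u where "u = fls_X * (fls_const (1/4) * (s + fls_const ((4 * of_nat (I mod 2) + 3) * second_diff (b i)) * geo))"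
      \<comment> \<open>\<open>m\<close> grows by 2 from block to block, hence \<open>4 m + 3\<close> by 8.\<close>
      define v where "v = fls_X * (fls_const (1/4) * (fls_const (8 * second_diff (b i)) * geo))"
      have c: "c k I = u + fls_const (of_nat k) * v" if "k \<noteq> 0" for k
      proof -
        have "fls_const ((4 * of_nat (2 * k + I mod 2) + 3) * second_diff (b i))
            = fls_const ((4 * of_nat (I mod 2) + 3) * second_diff (b i))
              + fls_const (of_nat k) * fls_const (8 * second_diff (b i))"
          by (simp only: fls_const_arith[symmetric]) (simp add: algebra_simps)
        moreover have "c k I = fls_X * (fls_const (1/4) * (s
            + fls_const ((4 * of_nat (2 * k + I mod 2) + 3) * second_diff (b i)) * geo))"
          using that unfolding c_def s_def i_def by (simp only: if_False)
        ultimately have "c k I = fls_X * (fls_const (1/4) * (s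
            + (fls_const ((4 * of_nat (I mod 2) + 3) * second_diff (b i))
              + fls_const (of_nat k) * fls_const (8 * second_diff (b i))) * geo))"
          by (simp only:)
        then show ?thesis unfolding u_def v_def by (simp only: distrib_left distrib_right mult_ac add_ac)
      qed
      have "k \<noteq> 0" "k + 1 \<noteq> 0" "k + 2 \<noteq> 0" using that by simp_all
      note c = this[THEN c]
      have of_nat: "fls_const (of_nat (k + 1)) = fls_const (of_nat k) + (1 :: rat fls)"
        "fls_const (of_nat (k + 2)) = fls_const (of_nat k) + (2 :: rat fls)"
        by (simp_all only: of_nat_add of_nat_1 of_nat_numeral fls_const_arith(1) fls_const_1 fls_const_numeral)
      define t :: "rat fls" where "t = fls_const (of_nat k)"
      show ?thesis unfolding c of_nat t_def[symmetric] by (simp only: algebra_simps) simp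
    qed
  qed (use i in simp_all)
  then show ?thesis by (simp add: x_def)
qed

section \<open>Monotone convergence\<close>

text \<open>
  Midpoint concavity on the dyadic intervals of length at least \<open>2\<^sup>1\<^sup>-\<^sup>n\<close>, phrased through \<open>T0\<close> and \<open>T1\<close> so that
  it follows the recursions of \<open>hash\<close> and \<open>phi\<close>.
\<close>

fun concave_to_depth :: "nat \<Rightarrow> (rat \<Rightarrow> rat) \<Rightarrow> bool" where
  "concave_to_depth 0 \<alpha> \<longleftrightarrow> True"
| "concave_to_depth (Suc n) \<alpha> \<longleftrightarrow>
     second_diff \<alpha> \<ge> 0 \<and> concave_to_depth n (T0 \<alpha>) \<and> concave_to_depth n (T1 \<alpha>)"

lemma second_diff_linear:
  "second_diff (\<alpha> + \<beta>) = second_diff \<alpha> + second_diff \<beta>"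
  "second_diff (fun_scale c \<alpha>) = c * second_diff \<alpha>"
  by (simp_all add: second_diff_def T0_add T1_add T0_scale T1_scale)
     (simp_all add: fun_scale_def algebra_simps)

lemma concave_to_depth_add:
  "concave_to_depth n \<alpha> \<Longrightarrow> concave_to_depth n \<beta> \<Longrightarrow> concave_to_depth n (\<alpha> + \<beta>)"
  by (induction n arbitrary: \<alpha> \<beta>) (simp_all only: concave_to_depth.simps second_diff_linear T0_add T1_add, simp_all)

lemma concave_to_depth_scale:
  "c \<ge> 0 \<Longrightarrow> concave_to_depth n \<alpha> \<Longrightarrow> concave_to_depth n (fun_scale c \<alpha>)"
  by (induction n arbitrary: \<alpha>) (simp_all add: second_diff_linear T0_scale T1_scale)

lemma fun_scale_fun_scale: "fun_scale c (fun_scale d \<alpha>) = fun_scale (c * d) \<alpha>"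
  by (simp add: fun_scale_def mult.assoc)

lemma concave_affine: "concave_to_depth n (fun_scale a oneX + fun_scale b tX)"
proof (induction n arbitrary: a b)
  case (Suc n)
  have "second_diff (fun_scale a oneX + fun_scale b tX) = 0"
    unfolding second_diff_linear
    by (simp add: second_diff_def T_oneX T_tX) (simp add: oneX_def tX_def on_dyadic_def fun_scale_def)
  moreover have "T0 (fun_scale a oneX + fun_scale b tX) = fun_scale a oneX + fun_scale (b / 2) tX"
    by (simp add: T0_add T0_scale T_oneX T_tX fun_scale_fun_scale)
  moreover have "T1 (fun_scale a oneX + fun_scale b tX) = fun_scale (a + b / 2) oneX + fun_scale (b / 2) tX"
    by (simp add: T1_add T1_scale T_oneX T_tX fun_scale_fun_scale)
      (simp add: fun_scale_def fun_eq_iff algebra_simps)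
  ultimately show ?case
    using Suc[of a "b / 2"] Suc[of "a + b / 2" "b / 2"]
    by (simp only: concave_to_depth.simps order_refl simp_thms)
qed simp

lemma concave_tX: "concave_to_depth n tX"
  using concave_affine[of n 0 1] by (simp add: fun_scale_def plus_fun_def)

lemma concave_one_minus_tX: "concave_to_depth n (oneX + fun_scale (-1) tX)"
  using concave_affine[of n 1 "-1"] by (simp add: fun_scale_def)

lemma concave_eps: "concave_to_depth n eps"
proof (induction n)
  case (Suc n)
  have "second_diff eps = 1/2"
    by (simp add: second_diff_def T_eps)
      (simp add: oneX_def tX_def eps_def on_dyadic_def fun_scale_def)
  then have "0 \<le> second_diff eps" by simp
  then show ?case
    unfolding concave_to_depth.simps T_eps
    by (intro conjI concave_to_depth_scale concave_to_depth_add Suc concave_tX concave_one_minus_tX) simp_all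
qed simp

lemma second_diff_phi: "second_diff (phi m) = (4 * of_nat m + 3) / 4"
proof -
  have [simp]: "eps 0 = 0" "eps 1 = 0" "tX 0 = 0" "tX 1 = 1" "oneX 0 = 1" "oneX 1 = 1"
    by (simp_all add: eps_def tX_def oneX_def on_dyadic_def)
  show ?thesis
  proof (cases "even m")
    case True
    then show ?thesis
      by (cases "m = 0") (simp_all add: second_diff_def T0_phi T1_phi, simp_all add: fun_scale_def)
  next
    case False
    then show ?thesis
      by (simp add: second_diff_def T0_phi T1_phi) (simp add: fun_scale_def)
  qed
qed

text \<open>
  \<open>T0\<close> and \<open>T1\<close> send each \<open>phi m\<close> to a nonnegative combination of functions \<open>phi\<close>, \<open>eps\<close>, \<open>t\<close> and
  \<open>1 - t\<close>, all of which are concave.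
\<close>

lemma concave_phi: "concave_to_depth n (phi m)"
proof (induction n arbitrary: m)
  case (Suc n)
  note closed = concave_to_depth_scale concave_to_depth_add Suc concave_tX concave_one_minus_tX concave_eps
  have "concave_to_depth n (T0 (phi m))"
  proof (cases "even m")
    case True
    show ?thesis unfolding T0_phi(1)[OF True] by (intro closed) simp_all
  next
    case False
    show ?thesis unfolding T0_phi(2)[OF False] by (intro closed) simp_all
  qed
  moreover have "concave_to_depth n (T1 (phi m))"
  proof (cases "even m")
    case True
    then consider "m = 0" | "even m" "m \<noteq> 0" by blast
    then show ?thesis
    proof cases
      case 1
      show ?thesis unfolding 1 T1_phi(1) by (intro closed) simp_all
    next
      case 2
      show ?thesis unfolding T1_phi(2)[OF 2] by (intro closed) simp_all
    qed
  next
    case False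
    show ?thesis unfolding T1_phi(3)[OF False] by (intro closed) simp_all
  qed
  ultimately show ?case by (simp add: second_diff_phi)
qed simp

lemma dyadic_unit_fraction: "0 \<le> i \<Longrightarrow> i \<le> 2 ^ n \<Longrightarrow> of_int i / 2 ^ n \<in> dyadic_unit"
proof -
  assume i: "0 \<le> i" "i \<le> 2 ^ n"
  then have "(of_int i :: rat) \<le> of_int (2 ^ n)" by (simp only: of_int_le_iff)
  then show ?thesis using i by (auto simp: dyadic_unit_def intro!: exI[of _ n])
qed

lemma convexX_T0: "convexX \<alpha> \<Longrightarrow> convexX (T0 \<alpha>)"
  unfolding convexX_def
proof (intro allI impI)
  fix n :: nat and i :: int
  assume c: "\<forall>n i. 0 < i \<and> i < 2 ^ n \<longrightarrow>
      \<alpha> (of_int (i - 1) / 2 ^ n) + \<alpha> (of_int (i + 1) / 2 ^ n) \<le> 2 * \<alpha> (of_int i / 2 ^ n)"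
    and i: "0 < i \<and> i < 2 ^ n"
  have "T0 \<alpha> (of_int j / 2 ^ n) = \<alpha> (of_int j / 2 ^ Suc n)" if "0 \<le> j" "j \<le> 2 ^ n" for j
    using dyadic_unit_fraction[OF that] by (simp add: T0_def on_dyadic_def mult.commute)
  moreover have "i < 2 ^ Suc n" using i by simp
  ultimately show "T0 \<alpha> (of_int (i - 1) / 2 ^ n) + T0 \<alpha> (of_int (i + 1) / 2 ^ n) \<le> 2 * T0 \<alpha> (of_int i / 2 ^ n)"
    using c[rule_format, of i "Suc n"] i by (simp del: power_Suc of_int_diff of_int_add)
qed

lemma convexX_T1: "convexX \<alpha> \<Longrightarrow> convexX (T1 \<alpha>)"
  unfolding convexX_def
proof (intro allI impI)
  fix n :: nat and i :: int
  assume c: "\<forall>n i. 0 < i \<and> i < 2 ^ n \<longrightarrow>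
      \<alpha> (of_int (i - 1) / 2 ^ n) + \<alpha> (of_int (i + 1) / 2 ^ n) \<le> 2 * \<alpha> (of_int i / 2 ^ n)"
    and i: "0 < i \<and> i < 2 ^ n"
  have T1: "T1 \<alpha> (of_int j / 2 ^ n) = \<alpha> (of_int (2 ^ n + j) / 2 ^ Suc n)" if "0 \<le> j" "j \<le> 2 ^ n" for j
  proof -
    have "(1 + of_int j / 2 ^ n) / 2 = (of_int (2 ^ n + j) / 2 ^ Suc n :: rat)" by (simp add: field_simps)
    then show ?thesis
      using dyadic_unit_fraction[OF that] by (simp only: T1_def on_dyadic_def if_True)
  qed
  have "0 < 2 ^ n + i" "2 ^ n + i < 2 ^ Suc n" using i by (simp_all add: add_pos_pos)
  moreover have "2 ^ n + i - 1 = 2 ^ n + (i - 1)" "2 ^ n + i + 1 = 2 ^ n + (i + 1)" by simp_all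
  moreover have "0 \<le> i - 1" "i - 1 \<le> 2 ^ n" "0 \<le> i" "i \<le> 2 ^ n" "0 \<le> i + 1" "i + 1 \<le> 2 ^ n"
    using i by simp_all
  ultimately show "T1 \<alpha> (of_int (i - 1) / 2 ^ n) + T1 \<alpha> (of_int (i + 1) / 2 ^ n) \<le> 2 * T1 \<alpha> (of_int i / 2 ^ n)"
    using c[rule_format, of "2 ^ n + i" "Suc n"] i
    by (simp only: T1 simp_thms)
qed

lemma convexX_imp_concave_to_depth: "convexX \<alpha> \<Longrightarrow> concave_to_depth n \<alpha>"
proof (induction n arbitrary: \<alpha>)
  case (Suc n)
  have "\<alpha> 0 + \<alpha> 1 \<le> 2 * \<alpha> (1 / 2)"
    using Suc.prems[unfolded convexX_def, rule_format, of 1 1] by simp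
  then have "second_diff \<alpha> \<ge> 0" by (simp add: second_diff_def T0_def T1_def on_dyadic_def)
  then show ?case using Suc convexX_T0 convexX_T1 by simp
qed simp

text \<open>
  At \<open>n = 0\<close> the difference of the two sides is the product of the second differences of \<open>\<alpha>\<close> and \<open>\<beta>\<close>.
\<close>

lemma hash_power2_mono:
  "concave_to_depth (Suc n) \<alpha> \<Longrightarrow> concave_to_depth (Suc n) \<beta> \<Longrightarrow>
    hash \<alpha> \<beta> (1 / 2 ^ n) \<le> 2 * hash \<alpha> \<beta> (1 / 2 ^ Suc n)"
proof (induction n arbitrary: \<alpha> \<beta>)
  case 0
  have "0 \<le> second_diff \<alpha> * second_diff \<beta>" using 0 by simp
  then show ?case
    unfolding hash_power2_Suc hash_power2_0 increment_halves[of \<alpha>, symmetric]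
      increment_halves[of \<beta>, symmetric] second_diff_def
    by (simp add: algebra_simps)
next
  case (Suc n)
  then have "hash (T0 \<alpha>) (T0 \<beta>) (1 / 2 ^ n) \<le> 2 * hash (T0 \<alpha>) (T0 \<beta>) (1 / 2 ^ Suc n)"
    "hash (T1 \<alpha>) (T1 \<beta>) (1 / 2 ^ n) \<le> 2 * hash (T1 \<alpha>) (T1 \<beta>) (1 / 2 ^ Suc n)"
    by simp_all
  from add_mono[OF this] show ?case
    unfolding hash_power2_Suc[of \<alpha> \<beta> n] hash_power2_Suc[of \<alpha> \<beta> "Suc n"] distrib_left .
qed

text \<open>
  The increment of \<open>\<alpha>\<close> over each dyadic interval of length \<open>2\<^sup>-\<^sup>n\<close> is at most \<open>L 2\<^sup>-\<^sup>n\<close> in absolute value.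
\<close>

fun lipschitz_to_depth :: "nat \<Rightarrow> rat \<Rightarrow> (rat \<Rightarrow> rat) \<Rightarrow> bool" where
  "lipschitz_to_depth 0 L \<alpha> \<longleftrightarrow> \<bar>\<alpha> 1 - \<alpha> 0\<bar> \<le> L"
| "lipschitz_to_depth (Suc n) L \<alpha> \<longleftrightarrow>
     lipschitz_to_depth n (L / 2) (T0 \<alpha>) \<and> lipschitz_to_depth n (L / 2) (T1 \<alpha>)"

lemma lipschitz_to_depth_mono:
  "lipschitz_to_depth n L \<alpha> \<Longrightarrow> L \<le> L' \<Longrightarrow> lipschitz_to_depth n L' \<alpha>"
proof (induction n arbitrary: L L' \<alpha>)
  case (Suc n)
  have "L / 2 \<le> L' / 2" using Suc.prems by simp
  then show ?case using Suc.IH Suc.prems(1) by auto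
qed auto

lemma lipschitz_to_depth_add:
  "lipschitz_to_depth n L \<alpha> \<Longrightarrow> lipschitz_to_depth n L' \<beta> \<Longrightarrow> lipschitz_to_depth n (L + L') (\<alpha> + \<beta>)"
proof (induction n arbitrary: L L' \<alpha> \<beta>)
  case (Suc n)
  then show ?case by (simp only: lipschitz_to_depth.simps T0_add T1_add add_divide_distrib simp_thms)
qed auto

lemma lipschitz_to_depth_scale:
  "c \<ge> 0 \<Longrightarrow> lipschitz_to_depth n L \<alpha> \<Longrightarrow> lipschitz_to_depth n (c * L) (fun_scale c \<alpha>)"
proof (induction n arbitrary: L \<alpha>)
  case 0
  then show ?case
    by (simp add: fun_scale_def abs_mult mult_left_mono flip: right_diff_distrib)
next
  case (Suc n)
  then show ?case
    by (simp add: T0_scale T1_scale flip: times_divide_eq_right)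
qed

lemma lipschitz_affine: "lipschitz_to_depth n \<bar>b\<bar> (fun_scale a oneX + fun_scale b tX)"
proof (induction n arbitrary: a b)
  case 0
  show ?case by (simp add: fun_scale_def oneX_def tX_def on_dyadic_def)
next
  case (Suc n)
  have "T0 (fun_scale a oneX + fun_scale b tX) = fun_scale a oneX + fun_scale (b / 2) tX"
    by (simp add: T0_add T0_scale T_oneX T_tX fun_scale_fun_scale)
  moreover have "T1 (fun_scale a oneX + fun_scale b tX) = fun_scale (a + b / 2) oneX + fun_scale (b / 2) tX"
    by (simp add: T1_add T1_scale T_oneX T_tX fun_scale_fun_scale)
      (simp add: fun_scale_def fun_eq_iff algebra_simps)
  moreover have "\<bar>b\<bar> / 2 = \<bar>b / 2\<bar>" by simp
  ultimately show ?case
    using Suc[of "b / 2" a] Suc[of "b / 2" "a + b / 2"]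
    by (simp only: lipschitz_to_depth.simps simp_thms)
qed

lemma lipschitz_tX: "lipschitz_to_depth n 1 tX"
  using lipschitz_affine[of n 1 0] by (simp add: fun_scale_def plus_fun_def)

lemma lipschitz_one_minus_tX: "lipschitz_to_depth n 1 (oneX + fun_scale (-1) tX)"
  using lipschitz_affine[of n "-1" 1] by (simp add: fun_scale_def)

lemma lipschitz_eps: "lipschitz_to_depth n 1 eps"
proof (induction n)
  case 0
  show ?case by (simp add: eps_def on_dyadic_def)
next
  case (Suc n)
  \<comment> \<open>the slope bounds of \<open>eps\<close> and of the linear term, both 1, scaled by \<open>1/4\<close>\<close>
  have *: "(1/2 :: rat) = 1/4 * (1 + 1)" by simp
  show ?case
    unfolding lipschitz_to_depth.simps T_eps *
    by (intro conjI lipschitz_to_depth_scale lipschitz_to_depth_add Suc lipschitz_tX lipschitz_one_minus_tX)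
      simp_all
qed

text \<open>
  The constant \<open>2 m + 2\<close> grows with \<open>m\<close> since the slopes \<open>4 m + 3\<close> do. It is large enough for the
  induction: \<open>(2 (m + 1) + 2 + 4 m + 3) / 8 \<le> (2 m + 2) / 2\<close>.
\<close>

lemma lipschitz_phi: "lipschitz_to_depth n (2 * of_nat m + 2) (phi m)"
proof (induction n arbitrary: m)
  case 0
  show ?case by simp
next
  case (Suc n)
  define M :: rat where "M = of_nat m"
  have M: "M \<ge> 0" by (simp add: M_def)
  have up: "lipschitz_to_depth n (2 * M + 4) (phi (m + 1))"
    using Suc[of "m + 1"] by (simp add: M_def algebra_simps)
  have down: "lipschitz_to_depth n (2 * M) (phi (m - 1))" if "m \<noteq> 0"
    using Suc[of "m - 1"] that by (simp add: M_def of_nat_diff algebra_simps)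
  have slope: "lipschitz_to_depth n ((4 * M + 3) * 1) (fun_scale (4 * M + 3) tX)"
    "lipschitz_to_depth n ((4 * M + 3) * 1) (fun_scale (4 * M + 3) (oneX + fun_scale (-1) tX))"
    using M by (intro lipschitz_to_depth_scale lipschitz_tX lipschitz_one_minus_tX; simp)+
  note mono = lipschitz_to_depth_mono[OF lipschitz_to_depth_scale[of "1/8"]]
  have with_up: "lipschitz_to_depth n ((2 * M + 2) / 2) (fun_scale (1/8) (phi (m + 1) + f))"
    if "lipschitz_to_depth n ((4 * M + 3) * 1) f" for f
    by (rule mono[OF _ lipschitz_to_depth_add[OF up that]]) (use M in simp_all)
  have with_down: "lipschitz_to_depth n ((2 * M + 2) / 2) (fun_scale (1/8) (phi (m - 1) + eps + f))"
    if "lipschitz_to_depth n ((4 * M + 3) * 1) f" "m \<noteq> 0" for f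
    by (rule mono[OF _ lipschitz_to_depth_add[OF lipschitz_to_depth_add[OF down[OF that(2)] lipschitz_eps] that(1)]])
      (use M in simp_all)
  have "lipschitz_to_depth n ((2 * M + 2) / 2) (T0 (phi m))"
  proof (cases "even m")
    case True
    from with_up[OF slope(1)] show ?thesis by (simp only: T0_phi(1)[OF True] M_def)
  next
    case False
    then have "m \<noteq> 0" by (metis even_zero)
    from with_down[OF slope(1) this] show ?thesis by (simp only: T0_phi(2)[OF False] M_def)
  qed
  moreover have "lipschitz_to_depth n ((2 * M + 2) / 2) (T1 (phi m))"
  proof (cases "m = 0")
    case True
    have "lipschitz_to_depth n (2 * M + 2) (phi 0)" using Suc[of 0] True by (simp add: M_def)
    from mono[OF _ lipschitz_to_depth_add[OF this slope(2)], of "(2 * M + 2) / 2"]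
    show ?thesis unfolding True T1_phi(1) using True by (simp add: M_def)
  next
    case False
    show ?thesis
    proof (cases "even m")
      case True
      from with_down[OF slope(2) False] show ?thesis by (simp only: T1_phi(2)[OF True False] M_def)
    next
      case False
      from with_up[OF slope(2)] show ?thesis by (simp only: T1_phi(3)[OF False] M_def)
    qed
  qed
  ultimately show ?case by (simp only: lipschitz_to_depth.simps M_def simp_thms)
qed

lemma lipschitzX_imp_lipschitz_to_depth:
  assumes "\<forall>s\<in>dyadic_unit. \<forall>t\<in>dyadic_unit. \<bar>\<alpha> s - \<alpha> t\<bar> \<le> L * \<bar>s - t\<bar>"
  shows "lipschitz_to_depth n L \<alpha>"
  using assms
proof (induction n arbitrary: L \<alpha>)
  case 0
  then show ?case using bspec[OF bspec[OF 0 dyadic_unit_1] dyadic_unit_0] by simp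
next
  case (Suc n)
  have "\<forall>s\<in>dyadic_unit. \<forall>t\<in>dyadic_unit. \<bar>T0 \<alpha> s - T0 \<alpha> t\<bar> \<le> L / 2 * \<bar>s - t\<bar>"
  proof (intro ballI)
    fix s t :: rat assume st: "s \<in> dyadic_unit" "t \<in> dyadic_unit"
    have abs_half: "\<bar>s / 2 - t / 2\<bar> = \<bar>s - t\<bar> / 2" by (simp add: abs_divide flip: diff_divide_distrib)
    show "\<bar>T0 \<alpha> s - T0 \<alpha> t\<bar> \<le> L / 2 * \<bar>s - t\<bar>"
      using Suc.prems[rule_format, OF dyadic_unit_half[OF st(1)] dyadic_unit_half[OF st(2)],
        unfolded abs_half] st
      by (simp add: T0_def on_dyadic_def)
  qed
  moreover have "\<forall>s\<in>dyadic_unit. \<forall>t\<in>dyadic_unit. \<bar>T1 \<alpha> s - T1 \<alpha> t\<bar> \<le> L / 2 * \<bar>s - t\<bar>"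
  proof (intro ballI)
    fix s t :: rat assume st: "s \<in> dyadic_unit" "t \<in> dyadic_unit"
    have abs_half: "\<bar>(1 + s) / 2 - (1 + t) / 2\<bar> = \<bar>s - t\<bar> / 2" by (simp add: abs_divide flip: diff_divide_distrib)
    show "\<bar>T1 \<alpha> s - T1 \<alpha> t\<bar> \<le> L / 2 * \<bar>s - t\<bar>"
      using Suc.prems[rule_format, OF dyadic_unit_half_right[OF st(1)] dyadic_unit_half_right[OF st(2)],
        unfolded abs_half] st
      by (simp add: T1_def on_dyadic_def)
  qed
  ultimately show ?case using Suc.IH by simp
qed

text \<open>
  Unfolded \<open>n\<close> times, \<open>hash \<alpha> \<beta> (1 / 2 ^ n)\<close> is the sum over the \<open>2\<^sup>n\<close> dyadic intervals of length
  \<open>2\<^sup>-\<^sup>n\<close> of the products of the increments of \<open>\<alpha>\<close> and \<open>\<beta>\<close>.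
\<close>

lemma abs_hash_power2_le:
  "lipschitz_to_depth n L \<alpha> \<Longrightarrow> lipschitz_to_depth n L' \<beta> \<Longrightarrow>
    \<bar>hash \<alpha> \<beta> (1 / 2 ^ n)\<bar> \<le> L * L' / 2 ^ n"
proof (induction n arbitrary: \<alpha> \<beta> L L')
  case 0
  then show ?case unfolding hash_power2_0 abs_mult by (simp add: mult_mono')
next
  case (Suc n)
  have "\<bar>hash (T0 \<alpha>) (T0 \<beta>) (1 / 2 ^ n)\<bar> \<le> L / 2 * (L' / 2) / 2 ^ n"
    "\<bar>hash (T1 \<alpha>) (T1 \<beta>) (1 / 2 ^ n)\<bar> \<le> L / 2 * (L' / 2) / 2 ^ n"
    by (rule Suc.IH; use Suc.prems in simp)+
  then have "\<bar>hash \<alpha> \<beta> (1 / 2 ^ Suc n)\<bar> \<le> 2 * (L / 2 * (L' / 2) / 2 ^ n)"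
    unfolding hash_power2_Suc by linarith
  also have "\<dots> = L * L' / 2 ^ Suc n" by simp
  finally show ?case .
qed

lemma mu_seq_tX_add_hash:
  assumes "convexX \<beta>" "lipschitzX \<beta>"
  shows "incseq (mu_seq (tX + hash \<beta> (phi 0)))" "convergent (mu_seq (tX + hash \<beta> (phi 0)))"
proof -
  let ?h = "\<lambda>n. hash \<beta> (phi 0) (1 / 2 ^ n)"
  have mu: "mu_seq (tX + hash \<beta> (phi 0)) n = of_rat (1 + 2 ^ n * ?h n)" for n
  proof -
    have "tX (1 / 2 ^ n) = 1 / 2 ^ n"
      using inverse_power2_in_dyadic_unit[of n] by (simp only: tX_def on_dyadic_def if_True)
    then have "2 ^ n * (tX + hash \<beta> (phi 0)) (1 / 2 ^ n) = 1 + 2 ^ n * ?h n"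
      by (simp add: distrib_left)
    moreover have "mu_seq (tX + hash \<beta> (phi 0)) n = of_rat (2 ^ n * (tX + hash \<beta> (phi 0)) (1 / 2 ^ n))"
      unfolding mu_seq_def of_rat_mult of_rat_power by simp
    ultimately show ?thesis by (simp only:)
  qed
  show inc: "incseq (mu_seq (tX + hash \<beta> (phi 0)))"
  proof (rule incseq_SucI)
    fix n
    have "?h n \<le> 2 * ?h (Suc n)"
      by (intro hash_power2_mono convexX_imp_concave_to_depth assms concave_phi)
    then have "2 ^ n * ?h n \<le> 2 ^ n * (2 * ?h (Suc n))" by (rule mult_left_mono) simp
    then show "mu_seq (tX + hash \<beta> (phi 0)) n \<le> mu_seq (tX + hash \<beta> (phi 0)) (Suc n)"
      unfolding mu of_rat_less_eq by (simp add: mult_ac)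
  qed
  obtain L where L: "\<forall>s\<in>dyadic_unit. \<forall>t\<in>dyadic_unit. \<bar>\<beta> s - \<beta> t\<bar> \<le> L * \<bar>s - t\<bar>"
    using assms(2) unfolding lipschitzX_def by blast
  have "mu_seq (tX + hash \<beta> (phi 0)) n \<le> of_rat (1 + L * 2)" for n
  proof -
    have "\<bar>?h n\<bar> \<le> L * 2 / 2 ^ n"
      using abs_hash_power2_le[OF lipschitzX_imp_lipschitz_to_depth[OF L] lipschitz_phi[of n 0]] by simp
    then have "2 ^ n * ?h n \<le> 2 ^ n * (L * 2 / 2 ^ n)" by (intro mult_left_mono) auto
    then show ?thesis unfolding mu of_rat_less_eq by simp
  qed
  then have "\<forall>n. mu_seq (tX + hash \<beta> (phi 0)) n \<le> of_rat (1 + L * 2)" ..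
  from incseq_convergent[OF inc this] obtain l where "mu_seq (tX + hash \<beta> (phi 0)) \<longlonglongrightarrow> l" .
  then show "convergent (mu_seq (tX + hash \<beta> (phi 0)))" by (rule convergentI)
qed

section \<open>Limits of coefficients of algebraic series\<close>

text \<open>
  Evaluation at \<open>w = 1\<close> on the ring of series with absolutely summable coefficients, where it is a
  ring homomorphism.
\<close>

definition abs_sums_at_1 :: "rat fps \<Rightarrow> real \<Rightarrow> bool" where
  "abs_sums_at_1 f s \<longleftrightarrow>
     summable (\<lambda>n. \<bar>of_rat (fps_nth f n) :: real\<bar>) \<and> (\<lambda>n. of_rat (fps_nth f n)) sums s"

lemma abs_sums_at_1_add:
  assumes "abs_sums_at_1 f s" "abs_sums_at_1 g t"
  shows "abs_sums_at_1 (f + g) (s + t)"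
proof -
  have "summable (\<lambda>n. \<bar>of_rat (fps_nth (f + g) n) :: real\<bar>)"
  proof (rule summable_comparison_test')
    show "summable (\<lambda>n. \<bar>of_rat (fps_nth f n)\<bar> + \<bar>of_rat (fps_nth g n) :: real\<bar>)"
      using assms unfolding abs_sums_at_1_def by (intro summable_add) auto
    show "norm \<bar>of_rat (fps_nth (f + g) n) :: real\<bar>
        \<le> \<bar>of_rat (fps_nth f n)\<bar> + \<bar>of_rat (fps_nth g n) :: real\<bar>" for n
      using abs_triangle_ineq[of "of_rat (fps_nth f n) :: real" "of_rat (fps_nth g n)"]
      by (simp add: of_rat_add)
  qed
  moreover have "(\<lambda>n. of_rat (fps_nth (f + g) n)) sums (s + t)"
    using sums_add[of "\<lambda>n. of_rat (fps_nth f n)" s "\<lambda>n. of_rat (fps_nth g n)" t] assms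
    by (simp add: abs_sums_at_1_def of_rat_add)
  ultimately show ?thesis by (simp add: abs_sums_at_1_def)
qed

lemma abs_sums_at_1_mult:
  assumes "abs_sums_at_1 f s" "abs_sums_at_1 g t"
  shows "abs_sums_at_1 (f * g) (s * t)"
proof -
  let ?f = "\<lambda>n. of_rat (fps_nth f n) :: real" and ?g = "\<lambda>n. of_rat (fps_nth g n) :: real"
  have f: "summable (\<lambda>n. norm (?f n))" "?f sums s" and g: "summable (\<lambda>n. norm (?g n))" "?g sums t"
    using assms by (simp_all add: abs_sums_at_1_def)
  have fg: "of_rat (fps_nth (f * g) n) = (\<Sum>i\<le>n. ?f i * ?g (n - i))" for n
    by (simp add: fps_mult_nth of_rat_sum of_rat_mult atLeast0AtMost)
  have "(\<lambda>n. \<Sum>i\<le>n. ?f i * ?g (n - i)) sums (s * t)"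
    using Cauchy_product_sums[OF f(1) g(1)] f(2) g(2) by (simp add: sums_unique[symmetric])
  moreover have "summable (\<lambda>n. \<bar>\<Sum>i\<le>n. ?f i * ?g (n - i)\<bar>)"
  proof (rule summable_comparison_test')
    show "summable (\<lambda>n. \<Sum>i\<le>n. norm (?f i) * norm (?g (n - i)))"
      by (rule summable_Cauchy_product) (use f(1) g(1) in simp_all)
    show "norm \<bar>\<Sum>i\<le>n. ?f i * ?g (n - i)\<bar> \<le> (\<Sum>i\<le>n. norm (?f i) * norm (?g (n - i)))" for n
      using norm_sum[of "\<lambda>i. ?f i * ?g (n - i)" "{..n}"] by (simp add: abs_mult)
  qed
  ultimately show ?thesis by (simp add: abs_sums_at_1_def fg)
qed

lemma abs_sums_at_1_poly: "abs_sums_at_1 (fps_of_poly p) (of_rat (poly p 1))"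
proof -
  have "summable (\<lambda>n. \<bar>of_rat (coeff p n) :: real\<bar>)"
    "(\<lambda>n. of_rat (coeff p n) :: real) sums (\<Sum>n\<le>degree p. of_rat (coeff p n))"
    by (auto intro!: summable_finite[of "{..degree p}"] sums_finite intro: le_degree)
  moreover have "(\<Sum>n\<le>degree p. of_rat (coeff p n) :: real) = of_rat (poly p 1)"
    by (simp add: poly_altdef of_rat_sum)
  ultimately show ?thesis by (simp add: abs_sums_at_1_def)
qed

lemma abs_sums_at_1_power: "abs_sums_at_1 f s \<Longrightarrow> abs_sums_at_1 (f ^ n) (s ^ n)"
proof (induction n)
  case 0
  show ?case using abs_sums_at_1_poly[of 1] by simp
qed (simp add: abs_sums_at_1_mult)

lemma abs_sums_at_1_sum:
  "(\<And>i. i \<in> I \<Longrightarrow> abs_sums_at_1 (f i) (s i)) \<Longrightarrow> abs_sums_at_1 (sum f I) (sum s I)"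
proof (induction I rule: infinite_finite_induct)
  case (insert i I)
  then show ?case by (simp add: abs_sums_at_1_add)
qed (use abs_sums_at_1_poly[of 0] in simp_all)

definition annihilates :: "rat poly poly \<Rightarrow> rat fps \<Rightarrow> bool" where
  "annihilates Q f \<longleftrightarrow> (\<Sum>j\<le>degree Q. fps_of_poly (coeff Q j) * f ^ j) = 0"

lemma annihilates_iff:
  assumes "degree Q \<le> n"
  shows "annihilates Q f \<longleftrightarrow> (\<Sum>j\<le>n. fps_of_poly (coeff Q j) * f ^ j) = 0"
proof -
  have "(\<Sum>j\<le>degree Q. fps_of_poly (coeff Q j) * f ^ j) = (\<Sum>j\<le>n. fps_of_poly (coeff Q j) * f ^ j)"
    using assms by (intro sum.mono_neutral_left) (auto simp: coeff_eq_0)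
  then show ?thesis by (simp add: annihilates_def)
qed

text \<open>
  Clear the denominators of the coefficients.
\<close>

lemma algebraic_over_rat_funs_imp_annihilates:
  assumes "algebraic_over rat_funs (fps_to_fls f)"
  obtains Q where "Q \<noteq> 0" "annihilates Q f"
proof -
  obtain p where p: "p \<noteq> 0" "\<And>i. coeff p i \<in> rat_funs" "poly p (fps_to_fls f) = 0"
    using assms unfolding algebraic_over_def by blast
  have "\<exists>a b. coeff p i = ratfun_of_poly a / ratfun_of_poly b \<and> b \<noteq> 0" for i
    using p(2)[of i] unfolding rat_funs_def by blast
  then obtain a b where ab: "\<And>i. coeff p i = ratfun_of_poly (a i) / ratfun_of_poly (b i)" "\<And>i. b i \<noteq> 0"
    by metis
  define n where "n = degree p"
  define B where "B = (\<Prod>i\<le>n. b i)"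
  \<comment> \<open>the numerators over the common denominator \<open>B\<close>\<close>
  define q where "q i = a i * (\<Prod>j\<in>{..n} - {i}. b j)" for i
  define Q where "Q = Poly (map q [0..<Suc n])"
  have coeff_Q: "coeff Q i = (if i \<le> n then q i else 0)" for i
    by (simp add: Q_def nth_default_def del: upt_Suc)
  have q: "ratfun_of_poly (q i) = ratfun_of_poly B * coeff p i" if "i \<le> n" for i
  proof -
    have "B = b i * (\<Prod>j\<in>{..n} - {i}. b j)"
      unfolding B_def using that by (simp add: prod.remove[of _ i])
    then show ?thesis
      using ab(2)[of i] by (simp add: q_def ab(1) ratfun_of_poly_mult field_simps)
  qed
  have "B \<noteq> 0" by (simp add: B_def ab(2))
  then have "coeff Q n \<noteq> 0"
    using q[of n] p(1) unfolding coeff_Q n_def by (auto simp: leading_coeff_neq_0)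
  then have "Q \<noteq> 0" by auto
  moreover have "annihilates Q f"
  proof -
    have "degree Q \<le> n" by (rule degree_le) (simp add: coeff_Q)
    have "fps_to_fls (\<Sum>j\<le>n. fps_of_poly (coeff Q j) * f ^ j)
        = (\<Sum>j\<le>n. ratfun_of_poly (coeff Q j) * fps_to_fls f ^ j)"
      by (induction n) (simp_all add: fls_times_fps_to_fls fps_to_fls_power)
    also have "\<dots> = ratfun_of_poly B * poly p (fps_to_fls f)"
      by (simp add: poly_altdef n_def[symmetric] sum_distrib_left coeff_Q q mult.assoc)
    also have "\<dots> = 0" by (simp add: p(3))
    finally have "(\<Sum>j\<le>n. fps_of_poly (coeff Q j) * f ^ j) = 0" by simp
    then show ?thesis using annihilates_iff[OF \<open>degree Q \<le> n\<close>] by simp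
  qed
  ultimately show thesis by (rule that)
qed

text \<open>
  Multiply the relation for \<open>f\<close> by \<open>c ^ degree Q\<close> and distribute the powers of \<open>c\<close>.
\<close>

lemma annihilates_rescale:
  assumes "Q \<noteq> 0" "annihilates Q f" "c \<noteq> 0"
  obtains R where "R \<noteq> 0" "annihilates R (fps_of_poly c * f)"
proof -
  define n where "n = degree Q"
  define R where "R = Poly (map (\<lambda>i. coeff Q i * c ^ (n - i)) [0..<Suc n])"
  have coeff_R: "coeff R i = (if i \<le> n then coeff Q i * c ^ (n - i) else 0)" for i
    by (simp add: R_def nth_default_def del: upt_Suc)
  have "coeff R n \<noteq> 0" using assms(1,3) by (simp add: coeff_R n_def)
  then have "R \<noteq> 0" by auto
  moreover have "annihilates R (fps_of_poly c * f)"
  proof -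
    have "degree R \<le> n" by (rule degree_le) (simp add: coeff_R)
    have "fps_of_poly (coeff R j) * (fps_of_poly c * f) ^ j
        = fps_of_poly c ^ n * (fps_of_poly (coeff Q j) * f ^ j)" if "j \<le> n" for j
    proof -
      have "fps_of_poly c ^ n = fps_of_poly c ^ (n - j) * fps_of_poly c ^ j"
        using that by (simp flip: power_add)
      then show ?thesis
        using that by (simp add: coeff_R fps_of_poly_mult fps_of_poly_power power_mult_distrib mult_ac)
    qed
    then have "(\<Sum>j\<le>n. fps_of_poly (coeff R j) * (fps_of_poly c * f) ^ j)
        = fps_of_poly c ^ n * (\<Sum>j\<le>n. fps_of_poly (coeff Q j) * f ^ j)"
      by (simp add: sum_distrib_left)
    then show ?thesis
      using annihilates_iff[OF \<open>degree R \<le> n\<close>] assms(2) by (simp add: annihilates_def n_def)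
  qed
  ultimately show thesis by (rule that)
qed

text \<open>
  If every coefficient vanishes at 1, the common factor \<open>w - 1\<close> can be cancelled, which lowers the
  degree of the leading coefficient; a relation with leading coefficient of least degree does the job.
\<close>

lemma annihilates_nonzero_at_1:
  assumes "Q \<noteq> 0" "annihilates Q f"
  obtains R j where "annihilates R f" "poly (coeff R j) 1 \<noteq> 0"
proof -
  obtain R where R: "R \<noteq> 0" "annihilates R f"
    and min: "\<And>S. S \<noteq> 0 \<Longrightarrow> annihilates S f \<Longrightarrow> degree (lead_coeff R) \<le> degree (lead_coeff S)"
    using ex_has_least_nat[of "\<lambda>Q. Q \<noteq> 0 \<and> annihilates Q f" Q "\<lambda>Q. degree (lead_coeff Q)"] assms
    by blast
  have "\<exists>j. poly (coeff R j) 1 \<noteq> 0"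
  proof (rule ccontr)
    assume "\<nexists>j. poly (coeff R j) 1 \<noteq> 0"
    then have "\<forall>j. [:-1, 1:] dvd coeff R j" by (simp add: poly_eq_0_iff_dvd)
    then have "[:[:-1, 1:]:] dvd R" by (simp add: const_poly_dvd_iff)
    then obtain S where S: "R = smult [:-1, 1:] S" by (auto elim: dvdE)
    then have "S \<noteq> 0" using R(1) by auto
    have "degree R = degree S" unfolding S by simp
    then have "(\<Sum>j\<le>degree S. fps_of_poly (coeff R j) * f ^ j)
        = fps_of_poly [:-1, 1:] * (\<Sum>j\<le>degree S. fps_of_poly (coeff S j) * f ^ j)"
      by (simp only: S coeff_smult fps_of_poly_mult sum_distrib_left mult.assoc)
    moreover have "fps_of_poly [:-1, 1 :: rat:] \<noteq> 0" by simp
    ultimately have "annihilates S f"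
      using R(2) \<open>degree R = degree S\<close> unfolding annihilates_def by simp
    moreover have "degree (lead_coeff R) = Suc (degree (lead_coeff S))"
      unfolding S lead_coeff_smult using \<open>S \<noteq> 0\<close> by (subst degree_mult_eq) auto
    ultimately show False using min[OF \<open>S \<noteq> 0\<close>] by simp
  qed
  then show thesis using that R(2) by blast
qed

text \<open>
  The factor \<open>1 - w\<close> turns the coefficients of \<open>f\<close> into their differences, which are nonnegative from
  the second one on and add up to \<open>\<mu>\<close>.
\<close>

lemma limit_algebraic:
  fixes f :: "rat fps"
  assumes alg: "algebraic_over rat_funs (fps_to_fls f)"
    and inc: "incseq (\<lambda>n. of_rat (fps_nth f n) :: real)"
    and lim: "(\<lambda>n. of_rat (fps_nth f n)) \<longlonglongrightarrow> (\<mu> :: real)"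
  shows "algebraic \<mu>"
proof -
  let ?s = "\<lambda>n. of_rat (fps_nth f n) :: real"
  define c :: "rat poly" where "c = [:1, -1:]"
  define g where "g = fps_of_poly c * f"
  have g_0: "fps_nth g 0 = fps_nth f 0"
    by (simp add: g_def c_def)
  have g_Suc: "fps_nth g (Suc n) = fps_nth f (Suc n) - fps_nth f n" for n
    by (simp add: g_def c_def fps_of_poly_pCons algebra_simps)
  have "(\<lambda>n. ?s (Suc n) - ?s n) sums (\<mu> - ?s 0)" by (rule telescope_sums[OF lim])
  then have tail: "(\<lambda>n. of_rat (fps_nth g (Suc n))) sums (\<mu> - ?s 0)"
    by (simp add: g_Suc of_rat_diff)
  have "\<bar>of_rat (fps_nth g (Suc n)) :: real\<bar> = of_rat (fps_nth g (Suc n))" for n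
    using incseq_SucD[OF inc, of n] by (simp add: g_Suc of_rat_diff)
  then have "summable (\<lambda>n. \<bar>of_rat (fps_nth g (Suc n)) :: real\<bar>)"
    using sums_summable[OF tail] by simp
  then have "summable (\<lambda>n. \<bar>of_rat (fps_nth g n) :: real\<bar>)" by (subst (asm) summable_Suc_iff)
  moreover have "(\<lambda>n. of_rat (fps_nth g n)) sums \<mu>"
    using tail by (subst (asm) sums_Suc_iff) (simp add: g_0)
  ultimately have g: "abs_sums_at_1 g \<mu>" by (simp add: abs_sums_at_1_def)
  obtain Q where "Q \<noteq> 0" "annihilates Q f" using algebraic_over_rat_funs_imp_annihilates[OF alg] .
  moreover have "c \<noteq> 0" by (simp add: c_def)
  ultimately obtain Q' where "Q' \<noteq> 0" "annihilates Q' g"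
    using annihilates_rescale unfolding g_def by metis
  then obtain R j where R: "annihilates R g" "poly (coeff R j) 1 \<noteq> 0"
    using annihilates_nonzero_at_1 by metis
  have "abs_sums_at_1 (\<Sum>j\<le>degree R. fps_of_poly (coeff R j) * g ^ j)
      (\<Sum>j\<le>degree R. of_rat (poly (coeff R j) 1) * \<mu> ^ j)"
    by (intro abs_sums_at_1_sum abs_sums_at_1_mult abs_sums_at_1_poly abs_sums_at_1_power g)
  then have "(\<lambda>n. 0) sums (\<Sum>j\<le>degree R. of_rat (poly (coeff R j) 1) * \<mu> ^ j)"
    using R(1) by (simp add: abs_sums_at_1_def annihilates_def)
  then have eq: "(\<Sum>j\<le>degree R. of_rat (poly (coeff R j) 1) * \<mu> ^ j) = 0"
    using sums_unique2 sums_zero by blast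
  define p :: "real poly" where "p = map_poly (\<lambda>q. of_rat (poly q 1)) R"
  have coeff_p: "coeff p i = of_rat (poly (coeff R i) 1)" for i by (simp add: p_def coeff_map_poly)
  show ?thesis
  proof (rule algebraicI')
    show "coeff p i \<in> \<rat>" for i by (simp add: coeff_p)
    show "p \<noteq> 0" using R(2) coeff_p[of j] by auto
    have "degree p \<le> degree R" by (rule degree_le) (simp add: coeff_p coeff_eq_0)
    then have "poly p \<mu> = (\<Sum>j\<le>degree R. coeff p j * \<mu> ^ j)"
      by (subst poly_altdef, intro sum.mono_neutral_left) (auto simp: coeff_eq_0)
    then show "poly p \<mu> = 0" using eq by (simp add: coeff_p)
  qed
qed

section \<open>Algebraicity of the series and of the limit\<close>

theorem theorem3p1:
  fixes \<beta>\<^sub>1 E\<^sub>1 :: "rat \<Rightarrow> rat"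
  assumes "\<beta>\<^sub>1 \<in> X"
    and "convexX \<beta>\<^sub>1"
    and "lipschitzX \<beta>\<^sub>1"
    and "\<exists>V. V \<subseteq> X \<and> finite_dim_subspace V \<and> T0 ` V \<subseteq> V \<and> T1 ` V \<subseteq> V \<and> \<beta>\<^sub>1 \<in> V"
    and "E\<^sub>1 = hash \<beta>\<^sub>1 (phi 0)"
  shows "algebraic_over rat_funs (fps_to_fls (S_series (tX + E\<^sub>1))) \<and>
    convergent (mu_seq (tX + E\<^sub>1)) \<and> algebraic (mu (tX + E\<^sub>1))"
proof -
  obtain V where V: "finite_dim_subspace V" "T0 ` V \<subseteq> V" "T1 ` V \<subseteq> V" "\<beta>\<^sub>1 \<in> V"
    using assms(4) by blast
  obtain B where B: "finite B" "V = qfun.span B"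
    using V(1) unfolding finite_dim_subspace_def by blast
  define d where "d = card B"
  obtain b where b: "bij_betw b {..<d} B"
    using ex_bij_betw_nat_finite[OF B(1)] unfolding d_def lessThan_atLeast0 by blast
  have expand: "\<exists>c. v = (\<Sum>j<d. fun_scale (c j) (b j))" if "v \<in> V" for v
  proof -
    obtain u where "v = (\<Sum>x\<in>B. fun_scale (u x) x)"
      using \<open>v \<in> V\<close> unfolding B(2) qfun.span_finite[OF B(1)] by blast
    also have "\<dots> = (\<Sum>j<d. fun_scale (u (b j)) (b j))"
      by (rule sum.reindex_bij_betw[OF b, symmetric])
    finally show ?thesis by (intro exI[of _ "\<lambda>j. u (b j)"])
  qed
  have bV: "b i \<in> V" if "i < d" for i
    using bij_betwE[OF b] that qfun.span_base[of "b i" B] by (auto simp: B(2))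
  have "\<exists>c. T0 (b i) = (\<Sum>j<d. fun_scale (c j) (b j))" if "i < d" for i
    using expand[of "T0 (b i)"] bV[OF that] V(2) by blast
  then obtain A0 where A0: "\<And>i. i < d \<Longrightarrow> T0 (b i) = (\<Sum>j<d. fun_scale (A0 i j) (b j))" by metis
  have "\<exists>c. T1 (b i) = (\<Sum>j<d. fun_scale (c j) (b j))" if "i < d" for i
    using expand[of "T1 (b i)"] bV[OF that] V(3) by blast
  then obtain A1 where A1: "\<And>i. i < d \<Longrightarrow> T1 (b i) = (\<Sum>j<d. fun_scale (A1 i j) (b j))" by metis
  obtain c where c: "\<beta>\<^sub>1 = (\<Sum>j<d. fun_scale (c j) (b j))" using expand[OF V(4)] by blast
  have "algebraic_over rat_funs (hash_series (b j) (phi 0))" if "j < d" for j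
    using algebraic_hash_series_phi[of d b A0 A1 j] A0 A1 that by blast
  moreover have "algebraic_over rat_funs (fls_const q)" for q
    by (intro rat_funs.algebraic_over_self fls_const_rat_funs)
  ultimately have "algebraic_over rat_funs (hash_series \<beta>\<^sub>1 (phi 0))"
    unfolding c hash_series_sum_left
    using alg_laurent.sum_mem[of "{..<d}" "\<lambda>j. fls_const (c j) * hash_series (b j) (phi 0)"]
      alg_laurent.mult_mem by simp
  \<comment> \<open>the summand \<open>t\<close> contributes the geometric series\<close>
  moreover have "fps_to_fls (S_series (tX + E\<^sub>1)) = geo + hash_series \<beta>\<^sub>1 (phi 0)"
  proof -
    have "S_series (tX + E\<^sub>1) = Abs_fps (\<lambda>_. 1) + S_series E\<^sub>1"
      using inverse_power2_in_dyadic_unit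
      by (intro fps_ext) (simp add: S_series_def tX_def on_dyadic_def distrib_right)
    moreover have "fps_to_fls (Abs_fps (\<lambda>_. 1 :: rat)) = geo"
    proof -
      have "S_series (hash tX tX) = Abs_fps (\<lambda>_. 1)"
        by (rule fps_ext) (simp add: S_series_def hash_power2_tX, simp add: tX_def on_dyadic_def)
      then have "fps_to_fls (Abs_fps (\<lambda>_. 1 :: rat)) = hash_series tX tX" by (simp add: hash_series_def)
      also have "\<dots> = geo" unfolding hash_series_tX by (simp add: tX_def on_dyadic_def)
      finally show ?thesis .
    qed
    ultimately show ?thesis by (simp add: hash_series_def assms(5))
  qed
  moreover have "algebraic_over rat_funs geo"
    by (intro rat_funs.algebraic_over_self geo_rat_funs)
  ultimately have alg: "algebraic_over rat_funs (fps_to_fls (S_series (tX + E\<^sub>1)))"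
    using alg_laurent.add_mem by simp
  have inc: "incseq (mu_seq (tX + E\<^sub>1))" and conv: "convergent (mu_seq (tX + E\<^sub>1))"
    using mu_seq_tX_add_hash[OF assms(2,3)] unfolding assms(5) by blast+
  have mu_seq: "mu_seq (tX + E\<^sub>1) = (\<lambda>n. of_rat (fps_nth (S_series (tX + E\<^sub>1)) n))"
    by (rule ext) (simp add: mu_seq_def S_series_def of_rat_mult of_rat_power mult.commute)
  have "algebraic (mu (tX + E\<^sub>1))"
  proof (rule limit_algebraic[OF alg])
    show "incseq (\<lambda>n. of_rat (fps_nth (S_series (tX + E\<^sub>1)) n) :: real)" using inc unfolding mu_seq .
    show "(\<lambda>n. of_rat (fps_nth (S_series (tX + E\<^sub>1)) n)) \<longlonglongrightarrow> mu (tX + E\<^sub>1)"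
      using conv by (simp only: convergent_LIMSEQ_iff mu_def mu_seq)
  qed
  with alg conv show ?thesis by blast
qed

end
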